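(* Let $\ell$ and $n$ be nonnegative integers and let $b,q$ be nonzero complex numbers such that no zero factor appears in any denominator occurring in the identity below. Fix a square root $\sqrt b$ of $b$. Then $$\sum_{k=0}^{n}\frac{1}{(q^{2-n}b;q^3)_k}\,\frac{(q^{-n};q)_k(q^\ell\sqrt b;q)_k(-\sqrt b;q)_k(\sqrt{qb};q)_k(-\sqrt{qb};q)_k}{(q;q)_k(q^\ell b;q)_k}\,q^{k}$$ $$=\frac{(q^{1-2n}/b;q)_n}{(q^{1-2n}/b;q^3)_n}\sum_{i=0}^{\ell}(-1)^n\,\frac{q^{\{(10n+6\ell-2)i-n-n^2\}/6}}{b^{(2n-5i)/6}}\,\frac{q-q^{2i}b}{q-b}\,\frac{(q^{-\ell};q)_i(q^{-n};q)_i(b/q;q)_i}{(q;q)_i(q^\ell b;q)_i(q^{n}b;q)_i}\cdot\frac{(q;q^3)_{\frac{n-i}{3}}(q^2;q^3)_{\frac{n-i}{3}}}{(q^{2-2n}/b;q^3)_{\frac{n-i}{3}}(q^{3-2n}/b;q^3)_{\frac{n-i}{3}}}\,\chi(n-i).$$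
   Context: For complex $x,q$ and an integer $m$, the $q$-shifted factorial is $(x;q)_m=\prod_{j=0}^{m-1}(1-xq^j)$ for $m>0$, $(x;q)_0=1$, and $(x;q)_m=1/\prod_{j=m}^{-1}(1-xq^j)$ for $m<0$; $(x;q^3)_m$ is the same with $q$ replaced by $q^3$. For an integer $N$, $\chi(N)=1$ if $3\mid N$ and $\chi(N)=0$ otherwise; a summand containing $\chi(n-i)=0$ is understood to be $0$, so only indices $i$ with $(n-i)/3\in\mathbb Z$ contribute (and for these the exponent of $q$ is an integer). With the fixed $\sqrt b$, $b^{(2n-5i)/6}$ means $(\sqrt b)^{(2n-5i)/3}$, where $(2n-5i)/3$ is an integer whenever $3\mid n-i$. $\sqrt{qb}$ denotes any fixed square root of $qb$. *)

theory Defs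
  imports Complex_Main
begin

text \<open>
  The shifted factorial \<open>(x;q)\<^sub>m\<close> for an arbitrary integer index. Since \<open>1 / 0 = 0\<close>,
  the condition \<open>qpoch x q m \<noteq> 0\<close> says, for either sign of \<open>m\<close>, that no factor of the
  defining product vanishes; for negative \<open>m\<close> this is the condition for
  \<open>(x;q)\<^sub>m\<close> to be defined.
\<close>

definition qpoch :: "complex \<Rightarrow> complex \<Rightarrow> int \<Rightarrow> complex" where
  "qpoch x q m =
     (if 0 \<le> m then \<Prod>j\<in>{0..m - 1}. (1 - x * q powi j)
      else 1 / (\<Prod>j\<in>{m..-1}. (1 - x * q powi j)))"

definition chi :: "int \<Rightarrow> complex" where
  "chi N = (if 3 dvd N then 1 else 0)"

end

theory Submission
  imports Defs "HOL-Analysis.Uncountable_Sets"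
begin

text \<open>
  Write \<open>s\<close> for the square root of \<open>b\<close>. A terminating very-well-poised \<open>6\<phi>5\<close> sum with parameters
  \<open>q\<^sup>-\<^sup>k\<close>, \<open>q\<^sup>-\<^sup>l\<close>, \<open>s\<close> expands \<open>(q\<^sup>l s;q)\<^sub>k / (q\<^sup>l b;q)\<^sub>k\<close> as \<open>(s;q)\<^sub>k / (b;q)\<^sub>k\<close> times a sum over
  \<open>i \<le> min k l\<close>. After exchanging the two sums, the inner sum over \<open>k\<close> is the case \<open>l = 0\<close> of the theorem
  with \<open>n - i\<close> and \<open>b q\<^sup>2\<^sup>i\<close> in place of \<open>n\<close> and \<open>b\<close>. That case is the inverse, under rational
  interpolation at the nodes \<open>q\<^sup>j\<close> with poles \<open>b q\<^sup>3\<^sup>j\<^sup>-\<^sup>1\<close>, of a balanced sum in base \<open>q\<^sup>3\<close>, which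
  explains why only indices with \<open>3 dvd n - i\<close> survive.

  All of this needs \<open>s\<close> to avoid the countable set where some \<open>b q\<^sup>j = 1\<close>; since both sides are
  continuous in \<open>s\<close> wherever the denominators of the identity do not vanish, the remaining values
  follow by density.
\<close>

section \<open>Finite q-products and their elementary identities\<close>

definition qfac :: "'a::field \<Rightarrow> 'a \<Rightarrow> nat \<Rightarrow> 'a" where
  "qfac x q k = (\<Prod>j<k. 1 - x * q ^ j)"

text \<open>For nonzero \<open>x\<close> this is \<open>x ^ k\<close> times the shifted factorial of
  \<open>1 / x\<close>. Being a polynomial in \<open>x\<close>, it avoids negative powers of
  \<open>q\<close>; at \<open>x = q ^ N\<close> it vanishes for \<open>k > N\<close>, which makes
  the sums below terminate.\<close>

definition qfall :: "'a::field \<Rightarrow> 'a \<Rightarrow> nat \<Rightarrow> 'a" where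
  "qfall x q k = (\<Prod>j<k. x - q ^ j)"

lemma qfac_0 [simp]: "qfac x q 0 = 1"
  by (simp add: qfac_def)

lemma qfac_Suc: "qfac x q (Suc k) = qfac x q k * (1 - x * q ^ k)"
  by (simp add: qfac_def)

lemma qfall_0 [simp]: "qfall x q 0 = 1"
  by (simp add: qfall_def)

lemma qfall_Suc: "qfall x q (Suc k) = qfall x q k * (x - q ^ k)"
  by (simp add: qfall_def)

lemma prod_lessThan_add:
  fixes f :: "nat \<Rightarrow> 'a::comm_monoid_mult"
  shows "(\<Prod>j<m + k. f j) = (\<Prod>j<m. f j) * (\<Prod>j<k. f (m + j))"
  by (induction k) (simp_all add: mult.assoc)

lemma qfac_add: "qfac x q (m + k) = qfac x q m * qfac (x * q ^ m) q k"
  unfolding qfac_def prod_lessThan_add by (simp add: power_add mult.assoc)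

lemma qfac_nonzero_iff: "qfac x q k \<noteq> 0 \<longleftrightarrow> (\<forall>j<k. x * q ^ j \<noteq> 1)"
  by (auto simp: qfac_def)

lemma qfall_power_eq_0: "N < i \<Longrightarrow> qfall (q ^ N) q i = 0"
  by (auto simp: qfall_def)

text \<open>Every factor after the first is \<open>q * x - q ^ (j + 1) = q * (x - q ^ j)\<close>.
  This compares \<open>q ^ N\<close> with \<open>q ^ (N + 1)\<close> in the recurrences
  below.\<close>

lemma qfall_scale: "qfall (q * x) q (Suc i) = q ^ i * (q * x - 1) * qfall x q i"
proof -
  have "qfall (q * x) q (Suc i) = (q * x - 1) * (\<Prod>j<i. q * (x - q ^ j))"
    unfolding qfall_def prod.lessThan_Suc_shift by (simp add: algebra_simps)
  then show ?thesis
    by (simp add: qfall_def prod.distrib)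
qed

lemma qfac_scale: "(1 - x) * qfac (q * x) q i = (1 - x * q ^ i) * qfac x q i"
  using qfac_add[of x q 1 i] qfac_Suc[of x q i] by (simp add: qfac_Suc mult_ac)

text \<open>Each factor is \<open>q ^ (i + k) - q ^ j = - q ^ j * (1 - q ^ (i + k - j))\<close>, so
  the product is a quotient of q-factorials; the exponent \<open>\<Sum>{..<i}\<close> is
  i(i-1)/2.\<close>

lemma qfall_power:
  "qfall (q ^ (i + k)) q i * qfac q q k = (- 1) ^ i * q ^ (\<Sum>{..<i}) * qfac q q (i + k)"
proof (induction i)
  case (Suc i)
  have "qfall (q ^ (Suc i + k)) q (Suc i) * qfac q q k =
     q ^ i * (q ^ (Suc i + k) - 1) * (qfall (q ^ (i + k)) q i * qfac q q k)"
    using qfall_scale[of q "q ^ (i + k)" i] by simp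
  then show ?case
    unfolding Suc.IH by (simp add: qfac_Suc power_add algebra_simps)
qed simp

section \<open>The terminating very-well-poised 6phi5 sum\<close>

text \<open>The sum is proved by telescoping in \<open>i\<close> the first-order recurrence in \<open>N\<close> satisfied by
  both sides; writing \<open>B\<close>, \<open>C\<close> for the reciprocals of two of the usual numerator parameters
  makes the summand symmetric in \<open>q ^ N\<close>, \<open>B\<close> and \<open>C\<close>.\<close>

lemma terminating_6phi5:
  fixes a B C q :: "'a::field"
  assumes q: "\<And>j. 0 < j \<Longrightarrow> j \<le> N \<Longrightarrow> q ^ j \<noteq> 1"
    and a: "\<And>j. j \<le> 2 * N \<Longrightarrow> a * q * q ^ j \<noteq> 1"
    and aB: "\<And>j. j < N \<Longrightarrow> a * q * B * q ^ j \<noteq> 1"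
    and aC: "\<And>j. j < N \<Longrightarrow> a * q * C * q ^ j \<noteq> 1"
  shows "(\<Sum>i\<le>N. (1 - a * q ^ (2 * i)) * qfac a q i * qfall (q ^ N) q i * qfall B q i * qfall C q i
             * (a * q) ^ i
           / (qfac q q i * qfac (a * q * q ^ N) q i * qfac (a * q * B) q i * qfac (a * q * C) q i))
         = (1 - a) * qfac (a * q) q N * qfac (a * q * B * C) q N
           / (qfac (a * q * B) q N * qfac (a * q * C) q N)"
  using assms
proof (induction N)
  case 0
  then show ?case by simp
next
  case (Suc N)
  define y where "y = q ^ N"
  define v where "v z i = qfac a q i * qfall z q i * qfall B q i * qfall C q i * (a * q) ^ i
     / (qfac q q i * qfac (a * q * z) q i * qfac (a * q * B) q i * qfac (a * q * C) q i)" for z i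
  define t where "t z i = (1 - a * q ^ (2 * i)) * v z i" for z i
  \<comment> \<open>\<open>g\<close> is the telescoping certificate, a rational multiple of the
    summand, and \<open>step\<close> is the property it is chosen for. It vanishes at
    \<open>Suc N\<close> because \<open>qfall (q ^ N) q (Suc N)\<close> does; \<open>base\<close>
    plays the part of \<open>g (-1) = 0\<close>.\<close>
  define g where "g i = q * y * a * (1 - a * q * y) * (1 - a * q ^ i) * (B - q ^ i) * (C - q ^ i)
     / (1 - a * q * y * q ^ i) * v y i" for i
  have nzy: "1 - a * q * y * q ^ i \<noteq> 0" if "i \<le> Suc N" for i
    using Suc.prems(2)[of "N + i"] that by (simp add: y_def power_add mult_ac)
  have step: "(1 - a * q * B * y) * (1 - a * q * C * y) * t (q * y) (Suc i)
      - (1 - a * q * y) * (1 - a * q * B * C * y) * t y (Suc i) = g (Suc i) - g i"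
    if i: "i \<le> N" for i
  proof -
    define x where "x = q ^ i"
    \<comment> \<open>\<open>w\<close> holds the common factors of the terms at \<open>i\<close> and
      \<open>Suc i\<close>. All of them become \<open>w\<close> times rational functions of
      \<open>a\<close>, \<open>B\<close>, \<open>C\<close>, \<open>q\<close>, \<open>x\<close>,
      \<open>y\<close>, and \<open>step\<close> reduces to a polynomial identity.\<close>
    define w where "w = qfac a q i * qfall y q i * qfall B q i * qfall C q i * (a * q) ^ i
     / (qfac q q (Suc i) * qfac (a * q * y) q (Suc i) * qfac (a * q * B) q (Suc i) * qfac (a * q * C) q (Suc i))"
    have nz: "1 - q * x \<noteq> 0" "1 - a * q * y * x \<noteq> 0" "1 - a * q * B * x \<noteq> 0" "1 - a * q * C * x \<noteq> 0"
       "1 - a * q * y * (q * x) \<noteq> 0" "1 - a * q * y \<noteq> 0"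
      using Suc.prems(1)[of "Suc i"] nzy[of i] Suc.prems(3)[of i] Suc.prems(4)[of i]
        nzy[of "Suc i"] nzy[of 0] i
      by (auto simp: x_def)
    have 1: "v y i = w * ((1 - q * x) * (1 - a * q * y * x) * (1 - a * q * B * x) * (1 - a * q * C * x))"
      using nz unfolding v_def w_def qfac_Suc qfall_Suc x_def[symmetric]
      by (simp add: divide_simps)
    have 2: "v y (Suc i) = w * ((1 - a * x) * (y - x) * (B - x) * (C - x) * (a * q))"
      unfolding v_def w_def by (simp add: qfac_Suc qfall_Suc x_def)
    have 3: "qfac (a * q * (q * y)) q (Suc i) =
        (1 - a * q * y * (q * x)) * qfac (a * q * y) q (Suc i) / (1 - a * q * y)"
      using qfac_scale[of "a * q * y" q "Suc i"] nz
      by (simp add: x_def divide_simps mult_ac)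
    have 4: "v (q * y) (Suc i) = w * ((1 - a * x) * (x * (q * y - 1)) * (B - x) * (C - x) * (a * q))
        * (1 - a * q * y) / (1 - a * q * y * (q * x))"
      unfolding v_def w_def qfall_scale 3
      by (simp add: qfac_Suc qfall_Suc x_def mult_ac)
    have 5: "q ^ (2 * Suc i) = q * q * (x * x)"
      by (simp add: x_def power_add mult_2)
    show ?thesis
      using nz unfolding t_def g_def 1 2 4 5 power_Suc x_def[symmetric]
      by (simp add: divide_simps) algebra
  qed
  have base: "(1 - a * q * B * y) * (1 - a * q * C * y) * t (q * y) 0
      - (1 - a * q * y) * (1 - a * q * B * C * y) * t y 0 = g 0"
    using nzy[of 0] by (simp add: t_def g_def v_def) algebra
  have "g (Suc N) = 0"
    by (simp add: g_def v_def y_def qfall_power_eq_0)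
  then have "(\<Sum>i\<le>Suc N. (1 - a * q * B * y) * (1 - a * q * C * y) * t (q * y) i
      - (1 - a * q * y) * (1 - a * q * B * C * y) * t y i) = 0"
    unfolding sum.atMost_Suc_shift base
    using sum_lessThan_telescope[of g "Suc N"] by (simp add: step lessThan_Suc_atMost)
  then have "(1 - a * q * B * y) * (1 - a * q * C * y) * (\<Sum>i\<le>Suc N. t (q * y) i)
      = (1 - a * q * y) * (1 - a * q * B * C * y) * (\<Sum>i\<le>Suc N. t y i)"
    by (simp add: sum_subtractf sum_distrib_left del: sum.atMost_Suc)
  also have "t y (Suc N) = 0"
    by (simp add: t_def v_def y_def qfall_power_eq_0)
  then have "(\<Sum>i\<le>Suc N. t y i) = (\<Sum>i\<le>N. t y i)"
    by simp
  also have "\<dots> = (1 - a) * qfac (a * q) q N * qfac (a * q * B * C) q N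
           / (qfac (a * q * B) q N * qfac (a * q * C) q N)"
    using Suc.IH Suc.prems by (simp add: t_def v_def y_def mult.assoc)
  finally have "(\<Sum>i\<le>Suc N. t (q * y) i) = (1 - a) * qfac (a * q) q (Suc N) * qfac (a * q * B * C) q (Suc N)
           / (qfac (a * q * B) q (Suc N) * qfac (a * q * C) q (Suc N))"
    using Suc.prems(3)[of N] Suc.prems(4)[of N]
    by (subst (asm) mult.commute, subst (asm) nonzero_eq_divide_eq[symmetric])
      (simp_all add: qfac_Suc y_def[symmetric] mult_ac del: sum.atMost_Suc)
  then show ?case
    by (simp add: t_def v_def y_def mult.assoc del: sum.atMost_Suc)
qed

section \<open>A balanced sum in base q^3\<close>

text \<open>A \<open>q\<close>-Pfaff-Saalschuetz sum in base \<open>q ^ 3\<close> with numerator parameters \<open>q\<^sup>-\<^sup>k\<close>, \<open>q\<^sup>1\<^sup>-\<^sup>k\<close>, \<open>q\<^sup>2\<^sup>-\<^sup>k\<close> for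
  \<open>k = K + 1\<close>. Stepping \<open>k\<close> by one and telescoping with the certificate \<open>g\<close> avoids a case distinction
  on \<open>k mod 3\<close>.\<close>

lemma cubic_balanced_sum:
  fixes b q :: "'a::field"
  assumes q0: "q \<noteq> 0"
    and q: "\<And>j. 0 < j \<Longrightarrow> j \<le> Suc K \<Longrightarrow> q ^ j \<noteq> 1"
    and b: "\<And>j. b * q ^ j \<noteq> 1"
  shows "(\<Sum>m\<le>K. (- b) ^ m * qfall (q ^ Suc K) q (3 * m) * qfac (b * q ^ 2) (q ^ 3) (K - m)
            / (q ^ (\<Sum>j<m. 3 * j + 1) * qfac (q ^ 3) (q ^ 3) m * qfac (b * q ^ 2) (q ^ 3) m))
         = qfac (b * q ^ Suc K) q K"
  using q
proof (induction K)
  case 0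
  then show ?case by simp
next
  case (Suc K)
  define y where "y = q ^ Suc K"
  define u where "u k m = (- b) ^ m * qfall (q ^ Suc k) q (3 * m) * qfac (b * q ^ 2) (q ^ 3) (k - m)
            / (q ^ (\<Sum>j<m. 3 * j + 1) * qfac (q ^ 3) (q ^ 3) m * qfac (b * q ^ 2) (q ^ 3) m)" for k m
  \<comment> \<open>With S(K) for the sum and y = q^(K+1), the recurrence is (1 - b y) S(K+1) = (1 -
    b y^2/q)(1 - b y^2) S(K), which the closed form satisfies as well.\<close>
  define g where "g m = - b * y * (q ^ (3 * m) - y) * (q * q ^ (3 * m) - y) / (q * q ^ (3 * m)) * u K m" for m
  have u0: "u k m = 0" if "Suc k < 3 * m" for k m
    by (simp add: u_def qfall_power_eq_0[OF that] del: power_Suc)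
  have step: "(1 - b * y) * u (Suc K) (Suc m) - (1 - b * y * y / q) * (1 - b * y * y) * u K (Suc m)
      = g (Suc m) - g m" if m: "m < K" for m
  \<comment> \<open>That \<open>1 - q ^ (3 * Suc m)\<close> is nonzero is known only for
    \<open>3 * Suc m \<le> Suc (Suc K)\<close>; beyond this bound all four terms vanish.\<close>
  proof (cases "3 * Suc m \<le> Suc (Suc K)")
    case True
    define x where "x = q ^ (3 * m)"
    define d where "d = K - Suc m"
    define z where "z = b * q ^ 2 * (q ^ 3) ^ d"
    define w where "w = (- b) ^ m * qfall y q (3 * m) * qfac (b * q ^ 2) (q ^ 3) d
       / (q ^ (\<Sum>j<Suc m. 3 * j + 1) * qfac (q ^ 3) (q ^ 3) (Suc m) * qfac (b * q ^ 2) (q ^ 3) (Suc m))"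
    have x0: "x \<noteq> 0"
      using q0 by (simp add: x_def)
    have Km: "K - m = Suc d" "Suc K - Suc m = Suc d" "K - Suc m = d"
      using m by (auto simp: d_def)
    have nz: "1 - q ^ 3 * x \<noteq> 0" "1 - b * q ^ 2 * x \<noteq> 0"
      using Suc.prems[of "3 * Suc m"] True b[of "2 + 3 * m"] by (auto simp: x_def power_add power2_eq_square mult_ac)
    \<comment> \<open>This eliminates \<open>z\<close>, the last factor of the product in base
      \<open>q ^ 3\<close>, and leaves a rational identity in \<open>b\<close>, \<open>q\<close>,
      \<open>x\<close>, \<open>y\<close>.\<close>
    have zx: "z * x * q ^ 4 = b * y ^ 3"
    proof -
      have "2 + 3 * d + 3 * m + 4 = Suc K * 3"
        using m by (simp add: d_def)
      then have "b * q ^ (2 + 3 * d + 3 * m + 4) = b * y ^ 3"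
        by (simp only: y_def power_mult)
      then show ?thesis
        by (simp add: z_def x_def power_add mult_ac flip: power_mult)
    qed
    have 1: "u K m = w * (x * q * (1 - q ^ 3 * x) * (1 - b * q ^ 2 * x) * (1 - z))"
    proof -
      have "p / (e * d1 * d2) = p / (e * (x * q) * (d1 * (1 - q ^ 3 * x)) * (d2 * (1 - b * q ^ 2 * x)))
          * (x * q * (1 - q ^ 3 * x) * (1 - b * q ^ 2 * x))" for p e d1 d2
        using nonzero_mult_divide_mult_cancel_right[of "x * q * (1 - q ^ 3 * x) * (1 - b * q ^ 2 * x)"
            p "e * d1 * d2"] nz q0 x0
        by (simp only: mult_ac times_divide_eq_left) simp
      note cancel = this[of "(- b) ^ m * qfall y q (3 * m) * (qfac (b * q ^ 2) (q ^ 3) d * (1 - z))"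
          "q ^ (\<Sum>j<m. 3 * j + 1)" "qfac (q ^ 3) (q ^ 3) m" "qfac (b * q ^ 2) (q ^ 3) m"]
      have e: "(q ^ 3) ^ m = x" "q ^ (\<Sum>j<Suc m. 3 * j + 1) = q ^ (\<Sum>j<m. 3 * j + 1) * (x * q)"
        by (simp_all add: x_def power_add power_mult)
      show ?thesis
        unfolding u_def w_def Km(1) qfac_Suc z_def[symmetric] y_def[symmetric] e cancel
        by (simp add: mult_ac)
    qed
    have 2: "u K (Suc m) = w * (- b * (y - x) * (y - q * x) * (y - q * q * x))"
      unfolding u_def w_def Km(3) by (simp add: qfall_Suc x_def y_def numeral_3_eq_3 mult_ac)
    have 3: "u (Suc K) (Suc m) = w * (- b * (1 - z) * (q * q * x) * (q * y - 1) * (y - x) * (y - q * x))"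
    proof -
      have e: "3 * Suc m = Suc (Suc (Suc (3 * m)))" "q ^ Suc (Suc K) = q * y"
        by (simp_all add: y_def)
      have "qfall (q ^ Suc (Suc K)) q (3 * Suc m) =
           q * q * x * (q * y - 1) * (qfall y q (3 * m) * (y - x) * (y - q * x))"
        unfolding e qfall_scale qfall_Suc[of y] by (simp add: x_def)
      then show ?thesis
        unfolding u_def w_def Km(2) qfac_Suc[of "b * q ^ 2" "q ^ 3" d] z_def[symmetric]
        by simp
    qed
    have 4: "q ^ (3 * Suc m) = q ^ 3 * x"
      by (simp add: x_def power_add)
    have 5: "z = b * y ^ 3 / (x * q ^ 4)"
      using zx x0 q0 by (simp add: field_simps)
    show ?thesis
      using q0 x0 unfolding g_def 1 2 3 4 5 x_def[symmetric]
      by (simp add: divide_simps) algebra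
  next
    case False
    have "u (Suc K) (Suc m) = 0" "u K (Suc m) = 0" "g (Suc m) = 0"
      using False by (simp_all add: u0 g_def)
    moreover have "g m = 0"
    proof -
      \<comment> \<open>In the first two cases \<open>u K m\<close> need not vanish; there the two
        factors \<open>q * q ^ (3 * m) - y\<close> and \<open>q ^ (3 * m) - y\<close> of
        \<open>g\<close> are zero.\<close>
      have "3 * m = K \<or> 3 * m = Suc K \<or> Suc K < 3 * m"
        using False by auto
      then show ?thesis
        by (elim disjE) (simp_all add: g_def y_def u0)
    qed
    ultimately show ?thesis by simp
  qed
  have base: "(1 - b * y) * u (Suc K) 0 - (1 - b * y * y / q) * (1 - b * y * y) * u K 0 = g 0"
  proof -
    have h: "b * q ^ 2 * (q ^ 3) ^ K = b * y ^ 3 / q"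
      using q0 by (simp add: y_def power_mult_distrib power3_eq_cube power2_eq_square
          mult.commute[of 3] flip: power_mult)
    show ?thesis
      using q0 by (simp add: u_def g_def qfac_Suc h) (simp add: divide_simps, algebra)
  qed
  have "g K = 0"
    by (cases "K = 0") (simp_all add: g_def y_def u0)
  then have "(\<Sum>m\<le>K. (1 - b * y) * u (Suc K) m - (1 - b * y * y / q) * (1 - b * y * y) * u K m) = 0"
    unfolding lessThan_Suc_atMost[symmetric] sum.lessThan_Suc_shift base
    using sum_lessThan_telescope[of g K] by (simp add: step)
  then have "(1 - b * y) * (\<Sum>m\<le>K. u (Suc K) m) = (1 - b * y * y / q) * (1 - b * y * y) * (\<Sum>m\<le>K. u K m)"
    by (simp add: sum_subtractf sum_distrib_left)
  also have "(\<Sum>m\<le>K. u K m) = qfac (b * y) q K"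
    using Suc.IH Suc.prems by (simp add: u_def y_def)
  also have "(\<Sum>m\<le>K. u (Suc K) m) = (\<Sum>m\<le>Suc K. u (Suc K) m)"
    by (simp add: u0)
  finally have "(1 - b * y) * (\<Sum>m\<le>Suc K. u (Suc K) m)
     = (1 - b * y * y / q) * (1 - b * y * y) * qfac (b * y) q K" .
  also have "\<dots> = (1 - b * y) * qfac (b * y * q) q (Suc K)"
    using qfac_add[of "b * y" q 1 "Suc K"] q0 by (simp add: qfac_Suc y_def mult_ac)
  finally have "(\<Sum>m\<le>Suc K. u (Suc K) m) = qfac (b * y * q) q (Suc K)"
    using b[of "Suc K"] by (simp add: y_def del: sum.atMost_Suc)
  then show ?case
    by (simp add: u_def y_def mult_ac del: sum.atMost_Suc)
qed

section \<open>Inversion of rational interpolation\<close>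

text \<open>The orthogonality relation behind the inversion telescopes because of
  \<open>(x\<^sub>n - x\<^sub>r) (x\<^sub>k - c\<^sub>k) = (x\<^sub>n - x\<^sub>k) (x\<^sub>r - c\<^sub>k) - (x\<^sub>n - c\<^sub>k) (x\<^sub>r - x\<^sub>k)\<close>.\<close>

lemma interpolation_inversion:
  fixes x c g :: "nat \<Rightarrow> 'a::field"
  assumes inj: "inj_on x {..n}" and c: "\<And>j. j \<le> n \<Longrightarrow> x n \<noteq> c j"
  shows "(\<Sum>k\<le>n. (x k - c k) * (\<Prod>j<k. x n - x j) / (\<Prod>j\<le>k. x n - c j)
            * (\<Sum>r\<le>k. g r * (\<Prod>j<k. x r - c j) / (\<Prod>j\<in>{..k} - {r}. x r - x j))) = g n"
proof -
  define f where "f r k = (x k - c k) * (\<Prod>j<k. x n - x j) * (\<Prod>j<k. x r - c j)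
     / ((\<Prod>j\<le>k. x n - c j) * (\<Prod>j\<in>{..k} - {r}. x r - x j))" for r k
  have orth: "(\<Sum>k=r..n. f r k) = 0" if r: "r < n" for r
  proof -
    \<comment> \<open>\<open>u (Suc N)\<close> is \<open>x n - x r\<close> times the partial sum up
      to \<open>N\<close>. At \<open>N = n\<close> it contains the factor \<open>x n - x n\<close>,
      so the full sum vanishes.\<close>
    define u where "u k = (\<Prod>j<k. x n - x j) * (\<Prod>j<k. x r - c j)
     / ((\<Prod>j<k. x n - c j) * (\<Prod>j\<in>{..<k} - {r}. x r - x j))" for k
    have "(x n - x r) * (\<Sum>k=r..N. f r k) = u (Suc N)" if "r \<le> N" "N \<le> n" for N
      using that
    proof (induction N rule: dec_induct)
      case base
      have "{..<Suc r} - {r} = {..<r}" "{..r} - {r} = {..<r}" by auto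
      then show ?case
        by (simp add: f_def u_def lessThan_Suc_atMost[symmetric] mult_ac)
    next
      case (step N)
      let ?k = "Suc N"
      have nz: "x n - c ?k \<noteq> 0" "x r - x ?k \<noteq> 0"
        using c[of ?k] inj step by (auto dest: inj_onD)
      have s: "{..<Suc ?k} - {r} = insert ?k ({..<?k} - {r})" "{..?k} - {r} = insert ?k ({..<?k} - {r})"
        using step by auto
      have "(x n - x r) * f r ?k = u (Suc ?k) - u ?k"
      proof -
        have "(xn - xr) * ((xk - ck) * p1 * p2 / (p3 * (xn - ck) * ((xr - xk) * p4)))
          = p1 * (xn - xk) * (p2 * (xr - ck)) / (p3 * (xn - ck) * ((xr - xk) * p4)) - p1 * p2 / (p3 * p4)"
          if "xn - ck \<noteq> 0" "xr - xk \<noteq> 0" for xn xr xk ck p1 p2 p3 p4 :: 'a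
        \<comment> \<open>If \<open>p3\<close> or \<open>p4\<close> is zero, both sides are 0
          because division by zero gives 0.\<close>
        proof (cases "p3 = 0 \<or> p4 = 0")
          case False
          then show ?thesis
            using that by (simp add: divide_simps) algebra
        qed auto
        note this[OF nz]
        then show ?thesis
          unfolding f_def u_def s lessThan_Suc_atMost[symmetric] prod.lessThan_Suc[of _ ?k] by simp
      qed
      then show ?case
        using step by (simp add: distrib_left)
    qed
    from this[of n] have "(x n - x r) * (\<Sum>k=r..n. f r k) = 0"
      using r by (simp add: u_def)
    moreover have "x n \<noteq> x r"
      using inj r by (auto dest: inj_onD)
    ultimately show ?thesis by simp
  qed
  have diag: "f n n = 1"
  proof -
    have "{..n} - {n} = {..<n}" by auto
    moreover have "(\<Prod>j<n. x n - x j) \<noteq> 0" "(\<Prod>j<n. x n - c j) \<noteq> 0"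
      using inj c by (auto dest: inj_onD)
    ultimately show ?thesis
      using c[of n] by (simp add: f_def lessThan_Suc_atMost[symmetric])
  qed
  have "(\<Sum>k\<le>n. (x k - c k) * (\<Prod>j<k. x n - x j) / (\<Prod>j\<le>k. x n - c j)
            * (\<Sum>r\<le>k. g r * (\<Prod>j<k. x r - c j) / (\<Prod>j\<in>{..k} - {r}. x r - x j)))
      = (\<Sum>k\<le>n. \<Sum>r\<le>k. g r * f r k)"
    by (simp add: f_def sum_distrib_left mult_ac)
  also have "\<dots> = (\<Sum>k\<le>n. \<Sum>r\<le>n. if r \<le> k then g r * f r k else 0)"
    by (intro sum.cong refl sum.mono_neutral_cong_left) auto
  also have "\<dots> = (\<Sum>r\<le>n. \<Sum>k\<le>n. if r \<le> k then g r * f r k else 0)"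
    by (rule sum.swap)
  also have "\<dots> = (\<Sum>r\<le>n. g r * (\<Sum>k=r..n. f r k))"
    unfolding sum_distrib_left by (intro sum.cong refl sum.mono_neutral_cong_right) auto
  also have "\<dots> = (\<Sum>r\<le>n. if r = n then g n else 0)"
    using orth diag by (intro sum.cong) auto
  finally show ?thesis by simp
qed

section \<open>The case l = 0 by inversion of the balanced sum\<close>

lemma qfac_triple:
  "qfac x q (3 * m) = qfac x (q ^ 3) m * qfac (x * q) (q ^ 3) m * qfac (x * q ^ 2) (q ^ 3) m"
proof (induction m)
  case (Suc m)
  have "3 * Suc m = Suc (Suc (Suc (3 * m)))"
    by simp
  moreover have "q ^ (3 * m) = (q ^ 3) ^ m" "q ^ Suc (3 * m) = q * (q ^ 3) ^ m"
    "q ^ Suc (Suc (3 * m)) = q ^ 2 * (q ^ 3) ^ m"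
    by (simp_all add: power2_eq_square mult_ac flip: power_mult)
  ultimately show ?case
    by (simp only: qfac_Suc Suc.IH) (simp only: mult_ac)
qed simp

text \<open>The factor at \<open>j\<close> is -b q^(3j+2) (1 - q^(3(m-j)-2) / b), and the exponents
  3(m-j)-2 run through 1, 4, ..., 3m-2 in reverse order. The induction peels off the factor at
  \<open>j = 0\<close> and takes \<open>q ^ 3\<close> out of the others.\<close>

lemma prod_reflect_triple:
  fixes b q :: "'a::field"
  assumes "b \<noteq> 0"
  shows "(\<Prod>j<m. q ^ (3 * m) - b * q ^ (3 * j + 2)) =
    (- b) ^ m * q ^ (\<Sum>j<m. 3 * j + 2) * qfac (q / b) (q ^ 3) m"
proof (induction m)
  case (Suc m)
  have "(\<Prod>j<Suc m. q ^ (3 * Suc m) - b * q ^ (3 * j + 2)) =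
      (q ^ (3 * Suc m) - b * q ^ 2) * (\<Prod>j<m. q ^ 3 * (q ^ (3 * m) - b * q ^ (3 * j + 2)))"
  proof -
    have "q ^ (3 * Suc k + e) = q ^ 3 * q ^ (3 * k + e)" for k e
      by (simp add: power_add)
    from this[of _ 2] this[of _ 0] show ?thesis
      unfolding prod.lessThan_Suc_shift by (simp only: right_diff_distrib mult.left_commute) (simp add: power2_eq_square)
  qed
  also have "\<dots> = (q ^ (3 * Suc m) - b * q ^ 2) * (q ^ (3 * m) *
      ((- b) ^ m * q ^ (\<Sum>j<m. 3 * j + 2) * qfac (q / b) (q ^ 3) m))"
    unfolding prod.distrib Suc.IH by (simp add: power_mult)
  also have "q ^ (3 * Suc m) - b * q ^ 2 = - b * q ^ 2 * (1 - q / b * (q ^ 3) ^ m)"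
    using assms by (simp add: power_add power_mult power2_eq_square power3_eq_cube field_simps)
  finally show ?case
    by (simp add: qfac_Suc power_add power2_eq_square mult_ac)
qed simp

text \<open>Factors with \<open>j < r\<close> form \<open>qfall\<close>, those with
  \<open>j > r\<close> are \<open>q ^ r * (1 - q ^ (j - r))\<close>. The product is the denominator
  belonging to node \<open>q ^ r\<close> in a divided difference.\<close>

lemma prod_power_diff_remove:
  fixes q :: "'a::field"
  shows "(\<Prod>j\<in>{..r + d} - {r}. q ^ r - q ^ j) = qfall (q ^ r) q r * q ^ (r * d) * qfac q q d"
proof (induction d)
  case 0
  have "{..r} - {r} = {..<r}" by auto
  then show ?case by (simp add: qfall_def)
next
  case (Suc d)
  have "{..r + Suc d} - {r} = insert (r + Suc d) ({..r + d} - {r})" by auto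
  then show ?case
    using Suc.IH by (simp add: qfac_Suc power_add algebra_simps)
qed

lemma sum_multiples_of_3:
  fixes f :: "nat \<Rightarrow> 'a::comm_monoid_add"
  shows "(\<Sum>r\<le>Suc K. if 3 dvd r then f (r div 3) else 0) = (\<Sum>m | m \<le> K \<and> 3 * m \<le> Suc K. f m)"
proof -
  have "(\<Sum>r\<le>Suc K. if 3 dvd r then f (r div 3) else 0) = (\<Sum>r\<in>{r\<in>{..Suc K}. 3 dvd r}. f (r div 3))"
    by (rule sum.inter_filter[symmetric]) simp
  also have "\<dots> = (\<Sum>m | m \<le> K \<and> 3 * m \<le> Suc K. f m)"
    by (rule sum.reindex_bij_witness[where i = "\<lambda>m. 3 * m" and j = "\<lambda>r. r div 3"]) auto
  finally show ?thesis .
qed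

text \<open>Identifies the term at node \<open>q ^ (3 * m)\<close> of the divided difference in
  \<open>interpolation_inversion\<close> with the m-th term of \<open>cubic_balanced_sum\<close>.
  Once the products are expressed through common ones, only the powers of \<open>q\<close>
  (\<open>exps\<close>) and the signs remain to be compared.\<close>

lemma cubic_coefficient:
  fixes b q :: "'a::field"
  assumes q0: "q \<noteq> 0" and b0: "b \<noteq> 0"
    and q: "\<And>j. 0 < j \<Longrightarrow> j \<le> Suc K \<Longrightarrow> q ^ j \<noteq> 1"
    and b: "\<And>j. b * q powi j \<noteq> 1"
    and m: "3 * m \<le> Suc K"
  shows "qfac q (q ^ 3) m * qfac (q ^ 2) (q ^ 3) m / (qfac (q / b) (q ^ 3) m * qfac (b * q ^ 2) (q ^ 3) m)
      * (\<Prod>j<K. q ^ (3 * m) - b * q ^ (3 * j + 2)) / (\<Prod>j\<in>{..Suc K} - {3 * m}. q ^ (3 * m) - q ^ j)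
    = (- b) ^ m * qfall (q ^ Suc K) q (3 * m) * qfac (b * q ^ 2) (q ^ 3) (K - m)
            / (q ^ (\<Sum>j<m. 3 * j + 1) * qfac (q ^ 3) (q ^ 3) m * qfac (b * q ^ 2) (q ^ 3) m)
      / qfac q q (Suc K)"
proof -
  obtain d where d: "Suc K = 3 * m + d"
    using m le_Suc_ex by blast
  define p where "p = K - m"
  have K: "K = m + p" and pd: "p + 1 = 2 * m + d"
    using d by (auto simp: p_def)
  let ?A = "\<Sum>j<m. 3 * j + 2" and ?E = "\<Sum>j<m. 3 * j + 1" and ?T = "\<Sum>{..<3 * m}"
  have exps: "?A + 3 * m * p + ?E = ?T + ?T + 3 * m * d"
  proof -
    have "?A + ?E = 3 * m * m"
      by (induction m) (simp_all add: algebra_simps)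
    moreover have "\<Sum>{..<k} + \<Sum>{..<k} + k = k * k" for k :: nat
      by (induction k) simp_all
    from this[of "3 * m"] have "?T + ?T + 3 * m = 9 * (m * m)"
      by simp
    moreover have "3 * m * p + 3 * m = 3 * m * (2 * m + d)"
      using pd by (metis mult.right_neutral distrib_left)
    ultimately show ?thesis
      by (simp add: algebra_simps)
  qed
  have qpow: "q ^ ?A * q ^ (3 * m * p) * q ^ ?E = q ^ ?T * q ^ ?T * q ^ (3 * m * d)"
    using exps by (simp only: power_add[symmetric])
  have F1: "(\<Prod>j<K. q ^ (3 * m) - b * q ^ (3 * j + 2)) = (- b) ^ m * q ^ ?A * qfac (q / b) (q ^ 3) m
     * (q ^ (3 * m * p) * qfac (b * q ^ 2) (q ^ 3) p)"
  proof -
    have "(\<Prod>j<p. q ^ (3 * m) - b * q ^ (3 * (m + j) + 2)) = (\<Prod>j<p. q ^ (3 * m) * (1 - b * q ^ 2 * (q ^ 3) ^ j))"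
    proof (rule prod.cong)
      fix j
      have "q ^ (3 * (m + j) + 2) = q ^ (3 * m) * (q ^ 2 * (q ^ 3) ^ j)"
        by (simp only: power_mult[symmetric] power_add[symmetric]) (simp add: algebra_simps)
      then show "q ^ (3 * m) - b * q ^ (3 * (m + j) + 2) = q ^ (3 * m) * (1 - b * q ^ 2 * (q ^ 3) ^ j)"
        by (simp only:) (simp add: algebra_simps)
    qed simp
    then show ?thesis
      unfolding K prod_lessThan_add prod_reflect_triple[OF b0]
      by (simp add: prod.distrib qfac_def power_mult)
  qed
  have F2: "(\<Prod>j\<in>{..Suc K} - {3 * m}. q ^ (3 * m) - q ^ j) =
     (- 1) ^ (3 * m) * q ^ ?T * qfac q q (3 * m) * q ^ (3 * m * d) * qfac q q d"
    using qfall_power[of q "3 * m" 0] unfolding d prod_power_diff_remove by simp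
  have F4: "qfall (q ^ Suc K) q (3 * m) * qfac q q d = (- 1) ^ (3 * m) * q ^ ?T * qfac q q (Suc K)"
    unfolding d by (rule qfall_power)
  have F5: "qfac q q (3 * m) = qfac q (q ^ 3) m * qfac (q ^ 2) (q ^ 3) m * qfac (q ^ 3) (q ^ 3) m"
    using qfac_triple[of q q m] by (simp add: power2_eq_square power3_eq_cube mult_ac)
  have qq: "qfac q q k \<noteq> 0" if "k \<le> Suc K" for k
    using q that by (auto simp: qfac_nonzero_iff simp flip: power_Suc)
  have nz1: "qfac q q d \<noteq> 0" "qfac q q (Suc K) \<noteq> 0" "qfac q q (3 * m) \<noteq> 0"
    using d by (auto intro!: qq)
  then have nz2: "qfac q (q ^ 3) m \<noteq> 0" "qfac (q ^ 2) (q ^ 3) m \<noteq> 0" "qfac (q ^ 3) (q ^ 3) m \<noteq> 0"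
    unfolding F5 by auto
  have nz3: "qfac (q / b) (q ^ 3) m \<noteq> 0"
    unfolding qfac_nonzero_iff
  proof safe
    fix j assume "q / b * (q ^ 3) ^ j = 1"
    then have "b = q powi int (3 * j + 1)"
      using b0 unfolding power_int_of_nat by (simp add: field_simps flip: power_mult)
    then have "b * q powi (- int (3 * j + 1)) = 1"
      using q0 by (simp flip: power_int_add)
    then show False using b by blast
  qed
  have nz4: "qfac (b * q ^ 2) (q ^ 3) m \<noteq> 0"
    unfolding qfac_nonzero_iff
    using b[of "int (2 + 3 * j)" for j] unfolding power_int_of_nat by (simp add: power_add power_mult power2_eq_square mult.assoc)
  \<comment> \<open>Cancellation with every product replaced by a variable; the last three
    assumptions are the square of the sign, \<open>F4\<close> and \<open>qpow\<close>.\<close>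
  have alg: "q1 * q2 / (qb * b2) * (B * qA * qb * (qP * bK)) / (sg * qT * (q1 * q2 * Qm) * qD * qd)
     = B * W * bK / (qE * Qm * b2) / qk"
    if "q1 \<noteq> 0" "q2 \<noteq> 0" "Qm \<noteq> 0" "qb \<noteq> 0" "b2 \<noteq> 0" "qd \<noteq> 0" "qk \<noteq> 0" "qT \<noteq> 0" "qE \<noteq> 0" "qD \<noteq> 0"
      "sg * sg = 1" "W * qd = sg * qT * qk" "qA * qP * qE = qT * qT * qD"
    for q1 q2 Qm qb b2 qd qk qT qE qD sg W qA qP B bK :: 'a
  proof -
    have sg: "sg \<noteq> 0" using that(11) by auto
    have W: "W = sg * qT * qk / qd" and qP: "qA * qP = qT * qT * qD / qE"
      using that by (simp_all add: field_simps)
    have "q1 * q2 / (qb * b2) * (B * qA * qb * (qP * bK)) / (sg * qT * (q1 * q2 * Qm) * qD * qd)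
      = (qA * qP) * B * bK / (b2 * sg * qT * Qm * qD * qd)"
      using that(1-10) by (simp add: mult_ac)
    also have "\<dots> = qT * B * bK / (qE * b2 * sg * Qm * qd)"
      unfolding qP using that(1-10) by (simp add: mult_ac)
    also have "\<dots> = sg * sg * qT * B * bK / (qE * b2 * sg * Qm * qd)"
      using that(11) by (simp add: mult_ac)
    also have "\<dots> = B * W * bK / (qE * Qm * b2) / qk"
      unfolding W using that(1-10) sg by (simp add: mult_ac)
    finally show ?thesis .
  qed
  show ?thesis
    unfolding F1 F2 F5 p_def[symmetric]
    by (rule alg) (use nz1 nz2 nz3 nz4 q0 F4 qpow in \<open>simp_all flip: power_mult_distrib\<close>)
qed


text \<open>The kernel (q^-n;q)_k / (q^(2-n) b;q^3)_k of the left-hand side, written as a rational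
  function of the node \<open>q ^ n\<close> as needed for interpolation.\<close>

definition qratio :: "'a::field \<Rightarrow> 'a \<Rightarrow> nat \<Rightarrow> nat \<Rightarrow> 'a" where
  "qratio b q n k = (\<Prod>j<k. (q ^ n - q ^ j) / (q ^ n - b * q ^ (3 * j + 2)))"

definition cubic_value :: "'a::field \<Rightarrow> 'a \<Rightarrow> nat \<Rightarrow> 'a" where
  "cubic_value b q n =
    (if 3 dvd n
     then qfac q (q ^ 3) (n div 3) * qfac (q ^ 2) (q ^ 3) (n div 3)
       / (qfac (q / b) (q ^ 3) (n div 3) * qfac (b * q ^ 2) (q ^ 3) (n div 3))
     else 0)"

text \<open>The sum is an interpolation series in \<open>q ^ n\<close>. By
  \<open>interpolation_inversion\<close> it suffices that its coefficients are the divided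
  differences of the claimed values, and \<open>cubic_balanced_sum\<close> evaluates those.\<close>

lemma cubic_summation:
  fixes b q :: "'a::field"
  assumes q0: "q \<noteq> 0" and b0: "b \<noteq> 0"
    and q: "\<And>j. 0 < j \<Longrightarrow> j \<le> n \<Longrightarrow> q ^ j \<noteq> 1"
    and b: "\<And>j. b * q powi j \<noteq> 1"
  shows "(\<Sum>k\<le>n. qratio b q n k * (q ^ k * qfac (b * q ^ k) q k / qfac q q k)) = cubic_value b q n"
proof -
  define x where "x j = q ^ j" for j :: nat
  define c where "c j = b * q ^ (3 * j) / q" for j :: nat
  define R where "R m = qfac q (q ^ 3) m * qfac (q ^ 2) (q ^ 3) m
      / (qfac (q / b) (q ^ 3) m * qfac (b * q ^ 2) (q ^ 3) m)" for m
  \<comment> \<open>The denominators of \<open>interpolation_inversion\<close> have one factor more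
    than \<open>qratio\<close>, namely the one for the pole \<open>c 0 = b / q\<close>. Dividing the
    target values by \<open>q ^ r - b / q\<close> compensates for it.\<close>
  define g where "g r = (if 3 dvd r then R (r div 3) else 0) / (q ^ r - b / q)" for r
  have bpow: "b * q ^ j \<noteq> 1" for j
    using b[of "int j"] by simp
  have nz: "q * q ^ r \<noteq> b * q ^ e" for r e
  proof
    assume "q * q ^ r = b * q ^ e"
    then have "b * q powi (int e - int (Suc r)) = 1"
      using q0 b0 by (simp add: power_int_diff power_int_add field_simps)
    then show False using b by blast
  qed
  have c0: "c 0 = b / q" and cSuc: "c (Suc j) = b * q ^ (3 * j + 2)" for j
    using q0 by (simp_all add: c_def power_add power3_eq_cube power2_eq_square)
  have xc: "x r - c j \<noteq> 0" for r j
    using nz[of r "3 * j"] q0 by (simp add: x_def c_def field_simps)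
  have inj: "inj_on x {..n}"
  proof (rule linorder_inj_onI)
    fix i j :: nat
    assume "i < j" "j \<in> {..n}"
    then have "q ^ (j - i) \<noteq> 1"
      using q[of "j - i"] by simp
    moreover have "q ^ j = q ^ i * q ^ (j - i)"
      using \<open>i < j\<close> by (simp flip: power_add)
    ultimately show "x i \<noteq> x j"
      using q0 by (simp add: x_def)
  qed auto
  have coeff: "(x k - c k) * (\<Sum>r\<le>k. g r * (\<Prod>j<k. x r - c j) / (\<Prod>j\<in>{..k} - {r}. x r - x j))
     = q ^ k * qfac (b * q ^ k) q k / qfac q q k" if "k \<le> n" for k
  proof (cases k)
    case 0
    then show ?thesis
      using xc[of 0 0] by (simp add: g_def R_def x_def c0)
  next
    case (Suc K)
    define u where "u m = (- b) ^ m * qfall (q ^ Suc K) q (3 * m) * qfac (b * q ^ 2) (q ^ 3) (K - m)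
            / (q ^ (\<Sum>j<m. 3 * j + 1) * qfac (q ^ 3) (q ^ 3) m * qfac (b * q ^ 2) (q ^ 3) m)" for m
    have q': "q ^ j \<noteq> 1" if "0 < j" "j \<le> Suc K" for j
      using q that \<open>k \<le> n\<close> Suc by simp
    have "(\<Sum>r\<le>k. g r * (\<Prod>j<k. x r - c j) / (\<Prod>j\<in>{..k} - {r}. x r - x j)) =
        (\<Sum>r\<le>Suc K. if 3 dvd r then R (r div 3) * (\<Prod>j<K. q ^ (3 * (r div 3)) - b * q ^ (3 * j + 2))
            / (\<Prod>j\<in>{..Suc K} - {3 * (r div 3)}. q ^ (3 * (r div 3)) - q ^ j) else 0)"
    proof (rule sum.cong)
      fix r
      have "(q ^ r - b / q) \<noteq> 0"
        using xc[of r 0] by (simp add: x_def c0)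
      then show "g r * (\<Prod>j<k. x r - c j) / (\<Prod>j\<in>{..k} - {r}. x r - x j) =
        (if 3 dvd r then R (r div 3) * (\<Prod>j<K. q ^ (3 * (r div 3)) - b * q ^ (3 * j + 2))
            / (\<Prod>j\<in>{..Suc K} - {3 * (r div 3)}. q ^ (3 * (r div 3)) - q ^ j) else 0)"
        unfolding Suc prod.lessThan_Suc_shift c0 cSuc by (simp add: g_def x_def)
    qed (simp add: Suc)
    also have "\<dots> = (\<Sum>m | m \<le> K \<and> 3 * m \<le> Suc K. R m * (\<Prod>j<K. q ^ (3 * m) - b * q ^ (3 * j + 2))
            / (\<Prod>j\<in>{..Suc K} - {3 * m}. q ^ (3 * m) - q ^ j))"
      by (rule sum_multiples_of_3)
    also have "\<dots> = (\<Sum>m | m \<le> K \<and> 3 * m \<le> Suc K. u m / qfac q q (Suc K))"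
      unfolding R_def u_def by (intro sum.cong refl cubic_coefficient q0 b0 q' b) auto
    also have "\<dots> = (\<Sum>m\<le>K. u m / qfac q q (Suc K))"
    proof (rule sum.mono_neutral_left)
      have "u m = 0" if "Suc K < 3 * m" for m
        unfolding u_def qfall_power_eq_0[OF that] by simp
      then show "\<forall>m\<in>{..K} - {m. m \<le> K \<and> 3 * m \<le> Suc K}. u m / qfac q q (Suc K) = 0"
        by (auto, metis not_le)
    qed auto
    also have "\<dots> = qfac (b * q ^ Suc K) q K / qfac q q (Suc K)"
      unfolding sum_divide_distrib[symmetric] u_def using cubic_balanced_sum[OF q0 q' bpow] by simp
    finally have 1: "(\<Sum>r\<le>k. g r * (\<Prod>j<k. x r - c j) / (\<Prod>j\<in>{..k} - {r}. x r - x j)) =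
      qfac (b * q ^ Suc K) q K / qfac q q (Suc K)" .
    \<comment> \<open>This supplies the last factor of \<open>qfac (b * q ^ k) q k\<close>; the
      balanced sum gives the first \<open>K\<close>.\<close>
    have 2: "x k - c k = q ^ Suc K * (1 - b * q ^ Suc K * q ^ K)"
    proof -
      have "3 * K + 2 = Suc K + (Suc K + K)"
        by simp
      then have "q ^ (3 * K + 2) = q ^ Suc K * (q ^ Suc K * q ^ K)"
        by (simp only: power_add)
      then show ?thesis
        unfolding Suc cSuc by (simp only: x_def) (simp add: algebra_simps)
    qed
    show ?thesis
      unfolding 1 2 unfolding Suc qfac_Suc[of "b * q ^ Suc K"] by simp
  qed
  have "(\<Sum>k\<le>n. (\<Prod>j<k. (q ^ n - q ^ j) / (q ^ n - b * q ^ (3 * j + 2)))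
            * (q ^ k * qfac (b * q ^ k) q k / qfac q q k))
     = (x n - c 0) * (\<Sum>k\<le>n. (x k - c k) * (\<Prod>j<k. x n - x j) / (\<Prod>j\<le>k. x n - c j)
            * (\<Sum>r\<le>k. g r * (\<Prod>j<k. x r - c j) / (\<Prod>j\<in>{..k} - {r}. x r - x j)))"
    unfolding sum_distrib_left[of "x n - c 0"]
  proof (rule sum.cong)
    fix k assume "k \<in> {..n}"
    then have k: "k \<le> n" by simp
    have "(\<Prod>j\<le>k. x n - c j) = (x n - c 0) * (\<Prod>j<k. q ^ n - b * q ^ (3 * j + 2))"
      unfolding lessThan_Suc_atMost[symmetric] prod.lessThan_Suc_shift cSuc by (simp add: x_def)
    then show "(\<Prod>j<k. (q ^ n - q ^ j) / (q ^ n - b * q ^ (3 * j + 2)))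
            * (q ^ k * qfac (b * q ^ k) q k / qfac q q k) =
       (x n - c 0) * ((x k - c k) * (\<Prod>j<k. x n - x j) / (\<Prod>j\<le>k. x n - c j)
            * (\<Sum>r\<le>k. g r * (\<Prod>j<k. x r - c j) / (\<Prod>j\<in>{..k} - {r}. x r - x j)))"
      unfolding coeff[OF k, symmetric] prod_dividef using xc[of n 0]
      by (simp add: x_def mult_ac)
  qed simp
  also have "\<dots> = (x n - c 0) * g n"
    using xc by (subst interpolation_inversion[OF inj]) auto
  also have "\<dots> = (if 3 dvd n then R (n div 3) else 0)"
    using xc[of n 0] by (simp add: g_def x_def c0)
  finally show ?thesis
    unfolding R_def qratio_def cubic_value_def .
qed

section \<open>Reflecting, splitting and merging products\<close>

text \<open>With E = e + d j, each factor is 1 - q^E / b = -(1/b) q^E (1 - b q^(-E)), and the order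
  of the factors is reversed. \<open>f\<close> is minus the last exponent E and \<open>z\<close> the
  sum of all of them; stating \<open>z\<close> through its double avoids a division of
  integers.\<close>

lemma qfac_reflect:
  fixes b q :: "'a::field"
  assumes q0: "q \<noteq> 0" and b0: "b \<noteq> 0"
    and f: "e + f + int d * (int N - 1) = 0" and z: "2 * z = int N * (e - f)"
  shows "qfac (q powi e / b) (q ^ d) N = (- 1 / b) ^ N * q powi z * qfac (b * q powi f) (q ^ d) N"
proof -
  have pw: "(q ^ d) ^ j = q powi (int d * int j)" for j
    by (simp only: power_mult[symmetric] of_nat_mult[symmetric] power_int_of_nat)
  have "qfac (q powi e / b) (q ^ d) N =
      (\<Prod>j<N. (- 1 / b) * q powi (e + int d * int j) * (1 - b * q powi (- (e + int d * int j))))"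
    unfolding qfac_def
  proof (rule prod.cong)
    fix j
    show "1 - q powi e / b * (q ^ d) ^ j =
       (- 1 / b) * q powi (e + int d * int j) * (1 - b * q powi (- (e + int d * int j)))"
      using q0 b0 unfolding pw by (simp add: power_int_minus power_int_add power_int_diff divide_simps)
  qed simp
  also have "\<dots> = (- 1 / b) ^ N * (\<Prod>j<N. q powi (e + int d * int j)) * (\<Prod>j<N. 1 - b * q powi (- (e + int d * int j)))"
    unfolding prod.distrib by simp
  also have "(\<Prod>j<N. q powi (e + int d * int j)) = q powi z"
  proof -
    have prod_pow: "(\<Prod>j<k. q powi (e + int d * int j)) = q powi (\<Sum>j<k. e + int d * int j)" for k
      using q0 by (induction k) (simp_all add: power_int_add)
    have sum_eq: "2 * (\<Sum>j<k. e + int d * int j) = int k * (2 * e + int d * (int k - 1))" for k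
      by (induction k) (simp_all add: algebra_simps)
    have "int d * (int N - 1) = - (e + f)"
      using f by simp
    then have "(\<Sum>j<N. e + int d * int j) = z"
      using sum_eq[of N] z by (simp only:) (simp add: algebra_simps)
    then show ?thesis by (simp add: prod_pow)
  qed
  also have "(\<Prod>j<N. 1 - b * q powi (- (e + int d * int j))) = qfac (b * q powi f) (q ^ d) N"
  proof -
    have "(\<Prod>j<N. 1 - b * q powi (- (e + int d * int j))) =
        (\<Prod>j<N. 1 - b * q powi (- (e + int d * int (N - Suc j))))"
      by (rule prod.nat_diff_reindex[symmetric])
    also have "\<dots> = qfac (b * q powi f) (q ^ d) N"
      unfolding qfac_def
    proof (rule prod.cong)
      fix j assume "j \<in> {..<N}"
      then have "- (e + int d * int (N - Suc j)) = f + int d * int j"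
        using f by (simp add: of_nat_diff algebra_simps)
      then show "1 - b * q powi (- (e + int d * int (N - Suc j))) = 1 - b * q powi f * (q ^ d) ^ j"
        using q0 unfolding pw by (simp add: power_int_add mult.assoc)
    qed simp
    finally show ?thesis .
  qed
  finally show ?thesis .
qed

lemma qfac_powi_eq_qfall:
  fixes q :: "'a::field"
  assumes "q \<noteq> 0"
  shows "qfac (q powi (- int n)) q k = q powi (- int n * int k) * qfall (q ^ n) q k"
proof (induction k)
  case (Suc k)
  have 1: "q powi (- int n * int (Suc k)) = q powi (- int n * int k) * q powi (- int n)"
    using assms by (simp add: algebra_simps flip: power_int_add)
  have 2: "q powi (- int n) * q ^ n = 1"
    using assms by (simp add: power_int_minus)
  have "P * W * (1 - p * y) = P * p * (W * (x - y))" if "p * x = 1" for P W p x y :: 'a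
    using that by algebra
  from this[OF 2] show ?case
    unfolding qfac_Suc qfall_Suc Suc.IH 1 .
qed simp

text \<open>Taking \<open>q ^ i\<close> out of numerator and denominator of the factor at
  \<open>i + j\<close> replaces \<open>n\<close> by \<open>n - i\<close> and \<open>b\<close> by
  \<open>b * q ^ (2 * i)\<close>. This is the origin of the shifted parameters in the inner
  sums.\<close>

lemma qratio_add:
  assumes "q \<noteq> 0" "i \<le> n"
  shows "qratio b q n (i + k) = qratio b q n i * qratio (b * q ^ (2 * i)) q (n - i) k"
proof -
  have "(q ^ n - q ^ (i + j)) / (q ^ n - b * q ^ (3 * (i + j) + 2)) =
      (q ^ (n - i) - q ^ j) / (q ^ (n - i) - b * q ^ (2 * i) * q ^ (3 * j + 2))" for j
  proof -
    have "q ^ n = q ^ i * q ^ (n - i)"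
      using assms by (simp flip: power_add)
    moreover have "q ^ (3 * (i + j) + 2) = q ^ i * (q ^ (2 * i) * q ^ (3 * j + 2))"
      by (simp only: power_add[symmetric]) (simp add: algebra_simps)
    ultimately have "(q ^ n - q ^ (i + j)) / (q ^ n - b * q ^ (3 * (i + j) + 2)) =
      (q ^ i * (q ^ (n - i) - q ^ j)) / (q ^ i * (q ^ (n - i) - b * q ^ (2 * i) * q ^ (3 * j + 2)))"
      by (simp only: power_add right_diff_distrib mult_ac)
    then show ?thesis
      using assms by simp
  qed
  then show ?thesis
    unfolding qratio_def prod_lessThan_add by simp
qed

lemma qratio_eq_qfac:
  assumes "q \<noteq> 0"
  shows "qratio b q n k = qfac (q powi (- int n)) q k / qfac (q powi (2 - int n) * b) (q ^ 3) k"
proof -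
  have "(q ^ n - q ^ j) / (q ^ n - b * q ^ (3 * j + 2)) =
     (1 - q powi (- int n) * q ^ j) / (1 - q powi (2 - int n) * b * (q ^ 3) ^ j)" for j
  proof -
    have "q ^ n - q ^ j = q ^ n * (1 - q powi (- int n) * q ^ j)"
      using assms by (simp add: power_int_minus algebra_simps)
    moreover have "q ^ n - b * q ^ (3 * j + 2) = q ^ n * (1 - q powi (2 - int n) * b * (q ^ 3) ^ j)"
      using assms by (simp add: power_int_diff algebra_simps power_add power2_eq_square flip: power_mult)
    ultimately show ?thesis
      using assms by simp
  qed
  then show ?thesis
    by (simp add: qratio_def qfac_def prod_dividef)
qed

lemma qfac_double: "qfac x q (2 * k) = qfac x (q ^ 2) k * qfac (x * q) (q ^ 2) k"
proof (induction k)
  case (Suc k)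
  have "2 * Suc k = Suc (Suc (2 * k))"
    by simp
  then show ?case
    by (simp only: qfac_Suc Suc.IH) (simp add: mult_ac flip: power_mult)
qed simp

text \<open>By (1 - x)(1 + x) = 1 - x^2. It also makes the product of the two factorials in
  \<open>sqrt_qb\<close> depend on \<open>q * b\<close> alone.\<close>

lemma qfac_minus: "qfac s q k * qfac (- s) q k = qfac (s ^ 2) (q ^ 2) k"
  unfolding qfac_def prod.distrib[symmetric]
  by (intro prod.cong) (simp_all add: power2_eq_square algebra_simps power_mult_distrib)

lemma sum_triangle:
  fixes f :: "nat \<Rightarrow> nat \<Rightarrow> 'a::comm_monoid_add"
  shows "(\<Sum>k\<le>n. \<Sum>i\<le>k. f i (k - i)) = (\<Sum>i\<le>n. \<Sum>k\<le>n - i. f i k)"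
proof -
  have "(\<Sum>k\<le>n. \<Sum>i\<le>k. f i (k - i)) = (\<Sum>(i, j)\<in>{(i, j). i + j \<le> n}. f i j)"
    by (rule sum.triangle_reindex_eq[symmetric])
  also have "{(i, j). i + j \<le> n} = Sigma {..n} (\<lambda>i. {..n - i})"
    by auto
  also have "(\<Sum>(i, j)\<in>Sigma {..n} (\<lambda>i. {..n - i}). f i j) = (\<Sum>i\<le>n. \<Sum>k\<le>n - i. f i k)"
    by (rule sum.Sigma[symmetric]) auto
  finally show ?thesis .
qed

section \<open>Reduction of general l to l = 0 for generic b\<close>

text \<open>The part independent of \<open>k\<close> of the i-th term of
  \<open>terminating_6phi5\<close> for \<open>a = s ^ 2 / q\<close>, \<open>B = 1 / s\<close>,
  \<open>C = q ^ l\<close>, divided by \<open>1 - a\<close> and without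
  \<open>1 / qfac q q i\<close>. The factors involving \<open>B\<close> have collapsed to
  \<open>s ^ i\<close> by \<open>qfall_inverse\<close>.\<close>

definition vwp_coeff :: "'a::field \<Rightarrow> 'a \<Rightarrow> nat \<Rightarrow> nat \<Rightarrow> 'a" where
  "vwp_coeff s q l i = (1 - s ^ 2 / q * q ^ (2 * i)) / (1 - s ^ 2 / q)
     * qfac (s ^ 2 / q) q i * qfall (q ^ l) q i / qfac (q ^ l * s ^ 2) q i * s ^ i"

lemma qfall_inverse: "s \<noteq> 0 \<Longrightarrow> qfall (1 / s) q i * s ^ i = qfac s q i"
  by (induction i) (simp_all add: qfall_Suc qfac_Suc field_simps)

lemma generic_power:
  assumes "\<And>j. x * q powi j \<noteq> 1"
  shows "x * q ^ j \<noteq> 1"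
  using assms[of "int j"] by simp

lemma generic_sqrt:
  fixes s :: "'a::field"
  assumes "\<And>j. s ^ 2 * q powi j \<noteq> 1"
  shows "s * q ^ j \<noteq> 1"
proof
  assume "s * q ^ j = 1"
  then have "s ^ 2 * q ^ (2 * j) = 1"
    by (simp add: power_mult_distrib mult.commute[of 2] power_mult flip: power_mult_distrib)
  then show False
    using generic_power[OF assms] by blast
qed

text \<open>\<open>terminating_6phi5\<close> with these parameters and \<open>N = k\<close>. The
  dependence on \<open>l\<close> moves into the coefficients, where it no longer interferes with the
  summation over \<open>k\<close>.\<close>

lemma shifted_ratio_expansion:
  fixes s q :: "'a::field"
  assumes q0: "q \<noteq> 0" and s0: "s \<noteq> 0"
    and q: "\<And>j. 0 < j \<Longrightarrow> j \<le> k \<Longrightarrow> q ^ j \<noteq> 1"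
    and gen: "\<And>j. s ^ 2 * q powi j \<noteq> 1"
  shows "qfac (q ^ l * s) q k / qfac (q ^ l * s ^ 2) q k = qfac s q k / qfac (s ^ 2) q k
     * (\<Sum>i\<le>k. vwp_coeff s q l i * qfall (q ^ k) q i / (qfac q q i * qfac (s ^ 2 * q ^ k) q i))"
proof -
  let ?a = "s ^ 2 / q"
  have a: "?a * q = s ^ 2" "s ^ 2 * (1 / s) = s"
    using q0 s0 by (simp_all add: power2_eq_square)
  have sq: "qfac s q i \<noteq> 0" for i
    using generic_sqrt[OF gen] by (simp add: qfac_nonzero_iff)
  have bq: "qfac (s ^ 2) q i \<noteq> 0" for i
    using generic_power[OF gen] by (simp add: qfac_nonzero_iff)
  have a1: "1 - ?a \<noteq> 0"
    using gen[of "- 1"] q0 by (simp add: power_int_minus field_simps)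
  have lq: "s ^ 2 * q ^ l * q ^ j \<noteq> 1" for j
    using generic_power[OF gen, of "l + j"] by (simp add: power_add mult_ac)
  have "(\<Sum>i\<le>k. (1 - ?a * q ^ (2 * i)) * qfac ?a q i * qfall (q ^ k) q i * qfall (1 / s) q i * qfall (q ^ l) q i
             * (?a * q) ^ i
           / (qfac q q i * qfac (?a * q * q ^ k) q i * qfac (?a * q * (1 / s)) q i * qfac (?a * q * q ^ l) q i))
         = (1 - ?a) * qfac (?a * q) q k * qfac (?a * q * (1 / s) * q ^ l) q k
           / (qfac (?a * q * (1 / s)) q k * qfac (?a * q * q ^ l) q k)"
    by (rule terminating_6phi5)
      (unfold a, use q generic_power[OF gen] generic_sqrt[OF gen] lq in auto)
  moreover have "(1 - ?a * q ^ (2 * i)) * qfac ?a q i * qfall (q ^ k) q i * qfall (1 / s) q i * qfall (q ^ l) q i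
             * (s ^ 2) ^ i
           / (qfac q q i * qfac (s ^ 2 * q ^ k) q i * qfac s q i * qfac (s ^ 2 * q ^ l) q i) =
      (1 - ?a) * (vwp_coeff s q l i * qfall (q ^ k) q i / (qfac q q i * qfac (s ^ 2 * q ^ k) q i))" for i
  proof -
    have 1: "qfall (1 / s) q i * (s ^ 2) ^ i = qfac s q i * s ^ i"
      using qfall_inverse[OF s0, of q i] by (simp add: power2_eq_square power_mult_distrib)
    have "x1 * w * x2 * t = x1 * x2 * p * r" if "w * t = r * p" for x1 x2 w t p r :: 'a
      using that by algebra
    from this[OF 1]
    have "(1 - ?a * q ^ (2 * i)) * qfac ?a q i * qfall (q ^ k) q i * qfall (1 / s) q i * qfall (q ^ l) q i
             * (s ^ 2) ^ i
       = (1 - ?a * q ^ (2 * i)) * qfac ?a q i * qfall (q ^ k) q i * qfall (q ^ l) q i * s ^ i * qfac s q i" .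
    moreover define D where "D = 1 - ?a"
    ultimately show ?thesis
      using sq[of i] a1 unfolding vwp_coeff_def D_def[symmetric] by (simp only:) (simp add: mult_ac)
  qed
  ultimately have "(1 - ?a) * (\<Sum>i\<le>k. vwp_coeff s q l i * qfall (q ^ k) q i / (qfac q q i * qfac (s ^ 2 * q ^ k) q i))
     = (1 - ?a) * (qfac (s ^ 2) q k * qfac (q ^ l * s) q k / (qfac s q k * qfac (q ^ l * s ^ 2) q k))"
    unfolding a by (simp add: sum_distrib_left mult_ac)
  then have "(\<Sum>i\<le>k. vwp_coeff s q l i * qfall (q ^ k) q i / (qfac q q i * qfac (s ^ 2 * q ^ k) q i))
     = qfac (s ^ 2) q k * qfac (q ^ l * s) q k / (qfac s q k * qfac (q ^ l * s ^ 2) q k)"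
    using a1 by (simp only: mult_cancel_left) simp
  then show ?thesis
    using sq[of k] bq[of k] by simp
qed

text \<open>Expand by \<open>shifted_ratio_expansion\<close>, put k = i + m and sum over m first.
  The inner sum is \<open>cubic_summation\<close> for \<open>n - i\<close> and
  \<open>b * q ^ (2 * i)\<close>.\<close>

lemma generic_reduction:
  fixes s q :: "'a::field"
  assumes q0: "q \<noteq> 0" and s0: "s \<noteq> 0"
    and q: "\<And>j. 0 < j \<Longrightarrow> j \<le> n \<Longrightarrow> q ^ j \<noteq> 1"
    and gen: "\<And>j. s ^ 2 * q powi j \<noteq> 1"
  shows "(\<Sum>k\<le>n. 1 / qfac (q powi (2 - int n) * s ^ 2) (q ^ 3) k
        * ((qfac (q powi (- int n)) q k * qfac (q ^ l * s) q k * qfac (- s) q k * qfac (q * s ^ 2) (q ^ 2) k)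
           / (qfac q q k * qfac (q ^ l * s ^ 2) q k)) * q ^ k)
    = (\<Sum>i\<le>n. vwp_coeff s q l i * (- 1) ^ i * q ^ (\<Sum>{..<i} + i) / qfac q q i
          * qratio (s ^ 2) q n i * cubic_value (s ^ 2 * q ^ (2 * i)) q (n - i))"
proof -
  let ?b = "s ^ 2"
  define h where "h i = vwp_coeff s q l i * (- 1) ^ i * q ^ (\<Sum>{..<i} + i) / qfac q q i * qratio ?b q n i" for i
  define f where "f i k = h i * (qratio (?b * q ^ (2 * i)) q (n - i) k
      * (q ^ k * qfac (?b * q ^ (2 * i) * q ^ k) q k / qfac q q k))" for i k
  have bq: "qfac ?b q i \<noteq> 0" for i
    using generic_power[OF gen] by (simp add: qfac_nonzero_iff)
  have qq: "qfac q q k \<noteq> 0" if "k \<le> n" for k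
    using q that by (auto simp: qfac_nonzero_iff simp flip: power_Suc)
  have "1 / qfac (q powi (2 - int n) * ?b) (q ^ 3) k
        * ((qfac (q powi (- int n)) q k * qfac (q ^ l * s) q k * qfac (- s) q k * qfac (q * ?b) (q ^ 2) k)
           / (qfac q q k * qfac (q ^ l * ?b) q k)) * q ^ k = (\<Sum>i\<le>k. f i (k - i))" if k: "k \<le> n" for k
  proof -
    have "1 / qfac (q powi (2 - int n) * ?b) (q ^ 3) k
        * ((qfac (q powi (- int n)) q k * qfac (q ^ l * s) q k * qfac (- s) q k * qfac (q * ?b) (q ^ 2) k)
           / (qfac q q k * qfac (q ^ l * ?b) q k)) * q ^ k
      = qratio ?b q n k * (qfac (q ^ l * s) q k / qfac (q ^ l * ?b) q k)
          * (qfac (- s) q k * qfac (?b * q) (q ^ 2) k) * q ^ k / qfac q q k"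
      unfolding qratio_eq_qfac[OF q0] by (simp add: mult_ac)
    also have "\<dots> = qratio ?b q n k * qfac ?b q (2 * k) / qfac ?b q k * q ^ k / qfac q q k
      * (\<Sum>i\<le>k. vwp_coeff s q l i * qfall (q ^ k) q i / (qfac q q i * qfac (?b * q ^ k) q i))"
      using shifted_ratio_expansion[OF q0 s0 q gen, of k l] k qfac_minus[of s q k]
      unfolding qfac_double by (simp add: mult_ac flip: qfac_minus)
    also have "\<dots> = (\<Sum>i\<le>k. f i (k - i))"
      unfolding sum_distrib_left
    proof (rule sum.cong)
      fix i assume "i \<in> {..k}"
      define m where "m = k - i"
      have km: "k = i + m"
        using \<open>i \<in> {..k}\<close> by (simp add: m_def)
      \<comment> \<open>The facts \<open>1\<close> to \<open>5\<close> split each product depending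
        on \<open>k\<close> into a part in \<open>i\<close> alone and the m-th factor of the inner
        sum; \<open>qfac ?b q (2 * i + m)\<close> occurs in \<open>1\<close> and \<open>2\<close>
        and cancels.\<close>
      have 1: "qfac ?b q k * qfac (?b * q ^ k) q i = qfac ?b q (2 * i + m)"
        unfolding qfac_add[symmetric] km by (simp add: mult_2 add_ac)
      have 2: "qfac ?b q (2 * k) = qfac ?b q (2 * i + m) * qfac (?b * q ^ (2 * i) * q ^ m) q m"
        using qfac_add[of ?b q "2 * i + m" m] unfolding km
        by (simp add: power_add mult_ac mult_2 add_ac)
      have 3: "qfall (q ^ k) q i / qfac q q k = (- 1) ^ i * q ^ (\<Sum>{..<i}) / qfac q q m"
        using qfall_power[of q i m] qq[of k] qq[of m] k unfolding km by (simp add: field_simps)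
      have 4: "qratio ?b q n k = qratio ?b q n i * qratio (?b * q ^ (2 * i)) q (n - i) m"
        unfolding km using k km by (intro qratio_add q0) simp
      have alg: "x * (c * d) / u * tp / v * (w * y / (z * e)) =
           w * g * r * p / z * x' * (d' * (t * d / m'))"
        if "u * e = c" "y / v = g * r / m'" "x = x' * d'" "c \<noteq> 0" "tp = t * p"
        for x c d u t p tp v w y z e g r x' d' m' :: 'a
      proof -
        have "x * (c * d) / u * tp / v * (w * y / (z * e)) = x * d * tp * w * (y / v) / z * (c / (u * e))"
          by (simp add: mult_ac)
        also have "\<dots> = w * g * r * p / z * x' * (d' * (t * d / m'))"
          unfolding that(1-3,5) using that(4) by (simp add: mult_ac)
        finally show ?thesis .
      qed
      have 5: "q ^ k = q ^ m * q ^ i"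
        unfolding km by (simp add: power_add)
      have "qratio ?b q n k * qfac ?b q (2 * k) / qfac ?b q k * q ^ k / qfac q q k
        * (vwp_coeff s q l i * qfall (q ^ k) q i / (qfac q q i * qfac (?b * q ^ k) q i)) =
          vwp_coeff s q l i * (- 1) ^ i * q ^ (\<Sum>{..<i}) * q ^ i / qfac q q i * qratio ?b q n i *
          (qratio (?b * q ^ (2 * i)) q (n - i) m * (q ^ m * qfac (?b * q ^ (2 * i) * q ^ m) q m / qfac q q m))"
        unfolding 2 by (rule alg[OF 1 3 4 bq 5])
      then show "qratio ?b q n k * qfac ?b q (2 * k) / qfac ?b q k * q ^ k / qfac q q k
        * (vwp_coeff s q l i * qfall (q ^ k) q i / (qfac q q i * qfac (?b * q ^ k) q i)) = f i (k - i)"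
        unfolding f_def h_def m_def[symmetric] power_add by (simp only: mult.assoc)
    qed simp
    finally show ?thesis .
  qed
  then have "(\<Sum>k\<le>n. 1 / qfac (q powi (2 - int n) * s ^ 2) (q ^ 3) k
        * ((qfac (q powi (- int n)) q k * qfac (q ^ l * s) q k * qfac (- s) q k * qfac (q * s ^ 2) (q ^ 2) k)
           / (qfac q q k * qfac (q ^ l * s ^ 2) q k)) * q ^ k) = (\<Sum>k\<le>n. \<Sum>i\<le>k. f i (k - i))"
    by simp
  also have "\<dots> = (\<Sum>i\<le>n. \<Sum>k\<le>n - i. f i k)"
    by (rule sum_triangle)
  also have "\<dots> = (\<Sum>i\<le>n. h i * cubic_value (?b * q ^ (2 * i)) q (n - i))"
  proof (rule sum.cong)
    fix i assume "i \<in> {..n}"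
    \<comment> \<open>Genericity survives the passage from \<open>b\<close> to
      \<open>b * q ^ (2 * i)\<close>, as \<open>j\<close> ranges over all integers.\<close>
    have "q powi (int (2 * i) + j) = q ^ (2 * i) * q powi j" for j
      unfolding power_int_of_nat[symmetric] using q0 by (intro power_int_add) simp
    then have "?b * q ^ (2 * i) * q powi j \<noteq> 1" for j
      using gen[of "int (2 * i) + j"] by (simp only: mult.assoc not_False_eq_True)
    then show "(\<Sum>k\<le>n - i. f i k) = h i * cubic_value (?b * q ^ (2 * i)) q (n - i)"
      unfolding f_def sum_distrib_left[symmetric] using q0 s0 q
      by (subst cubic_summation) auto
  qed simp
  finally show ?thesis
    unfolding h_def .
qed

section \<open>Matching the summands of the right-hand side\<close>

lemma powi_add_nat: "q \<noteq> 0 \<Longrightarrow> q powi (e + int k) = q powi e * (q :: 'a::field) ^ k"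
  by (simp add: power_int_add)

lemma double_div_2: "even (x :: int) \<Longrightarrow> 2 * (x div 2) = x"
  by simp

text \<open>Every product in \<open>1 / b\<close> is reflected into one in \<open>b\<close>; \<open>z1\<close> to \<open>z5\<close> are the exponents of \<open>q\<close>
  that these reflections produce.\<close>

lemma rhs_summand:
  fixes s q :: "'a::field"
  assumes q0: "q \<noteq> 0" and s0: "s \<noteq> 0"
    and gen: "\<And>j. s ^ 2 * q powi j \<noteq> 1"
    and n: "n = i + 3 * m"
  shows "qfac (q powi (1 - 2 * int n) / s ^ 2) q n / qfac (q powi (1 - 2 * int n) / s ^ 2) (q ^ 3) n
     * ((- 1) ^ n
       * (q powi (((10 * int n + 6 * int l - 2) * int i - int n - (int n) ^ 2) div 6) * s ^ i / (s ^ 2) ^ m)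
       * ((q - q ^ (2 * i) * s ^ 2) / (q - s ^ 2))
       * ((qfac (q powi (- int l)) q i * qfac (q powi (- int n)) q i * qfac (s ^ 2 / q) q i)
          / (qfac q q i * qfac (q ^ l * s ^ 2) q i * qfac (q ^ n * s ^ 2) q i))
       * ((qfac q (q ^ 3) m * qfac (q ^ 2) (q ^ 3) m)
          / (qfac (q powi (2 - 2 * int n) / s ^ 2) (q ^ 3) m * qfac (q powi (3 - 2 * int n) / s ^ 2) (q ^ 3) m)))
    = vwp_coeff s q l i * (- 1) ^ i * q ^ (\<Sum>{..<i} + i) / qfac q q i
          * qratio (s ^ 2) q n i * cubic_value (s ^ 2 * q ^ (2 * i)) q (n - i)"
proof -
  define b where "b = s ^ 2"
  have b0: "b \<noteq> 0"
    using s0 by (simp add: b_def)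
  have nz: "qfac (b * q powi e) (q ^ d) N \<noteq> 0" for e d N
    unfolding qfac_nonzero_iff
  proof safe
    fix j assume "b * q powi e * (q ^ d) ^ j = 1"
    moreover have "q powi (e + int (d * j)) = q powi e * (q ^ d) ^ j"
      by (simp only: powi_add_nat[OF q0] power_mult)
    ultimately show False
      using gen[of "e + int (d * j)"] by (simp add: b_def mult.assoc)
  qed
  \<comment> \<open>Up to signs and powers of \<open>b\<close> and \<open>q\<close>, the prefactor
    is (G * Y 0 * Y 1 * Y 2) / (D * Y5 * V * Y 2). \<open>G\<close>, \<open>Y 0\<close> and
    \<open>Y 1\<close> cancel against denominators of the summand; \<open>D\<close> goes to
    \<open>qratio\<close>, and \<open>Y5 * V\<close> to \<open>cubic_value\<close>.\<close>
  define X5 where "X5 = qfac (q / (b * q ^ (2 * i))) (q ^ 3) m"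
  define V where "V = qfac (b * q ^ (2 * i) * q ^ 2) (q ^ 3) m"
  define G where "G = qfac (q ^ n * b) q i"
  define D where "D = qfac (q powi (2 - int n) * b) (q ^ 3) i"
  define Y where "Y r = qfac (b * q powi (int n + int i + r)) (q ^ 3) m" for r
  define Y5 where "Y5 = qfac (b * q powi (2 + 2 * int i - 3 * int m)) (q ^ 3) m"
  define z1 where "z1 = (int n * (1 - 3 * int n)) div 2"
  define z2 where "z2 = (int n * (- 1 - int n)) div 2"
  define z3 where "z3 = (int m * (1 - 3 * int n - int i)) div 2"
  define z4 where "z4 = (int m * (3 - 3 * int n - int i)) div 2"
  define z5 where "z5 = (int m * (- 1 - 4 * int i + 3 * int m)) div 2"
  define e where "e = ((10 * int n + 6 * int l - 2) * int i - int n - (int n) ^ 2) div 6"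
  note refl = qfac_reflect[OF q0 b0]
  have z: "2 * z1 = int n * (1 - 3 * int n)" "2 * z2 = int n * (- 1 - int n)"
     "2 * z3 = int m * (1 - 3 * int n - int i)" "2 * z4 = int m * (3 - 3 * int n - int i)"
     "2 * z5 = int m * (- 1 - 4 * int i + 3 * int m)"
    unfolding z1_def z2_def z3_def z4_def z5_def n by - (rule double_div_2, force)+
  have X1: "qfac (q powi (1 - 2 * int n) / b) q n = (- 1 / b) ^ n * q powi z1 * (G * (Y 0 * Y 1 * Y 2))"
  proof -
    have "qfac (q powi (1 - 2 * int n) / b) (q ^ 1) n = (- 1 / b) ^ n * q powi z1 * qfac (b * q powi int n) (q ^ 1) n"
      by (rule refl) (use z in \<open>simp_all add: algebra_simps\<close>)
    moreover have "qfac (b * q powi int n) q n = G * qfac (b * q powi (int n + int i)) q (3 * m)"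
      using qfac_add[of "b * q ^ n" q i "3 * m", folded n]
      unfolding G_def powi_add_nat[OF q0] power_int_of_nat by (simp add: mult_ac)
    moreover have "qfac (b * q powi (int n + int i)) q (3 * m) = Y 0 * Y 1 * Y 2"
      unfolding qfac_triple Y_def using q0 by (simp add: power_int_add mult_ac)
    ultimately show ?thesis by simp
  qed
  have X2: "qfac (q powi (1 - 2 * int n) / b) (q ^ 3) n = (- 1 / b) ^ n * q powi z2 * (D * (Y5 * V * Y 2))"
  proof -
    have pw: "q powi a * (q ^ 3) ^ k = q powi (a + 3 * int k)" for a k
      using powi_add_nat[OF q0, of a "3 * k"] by (simp add: power_mult)
    have "qfac (q powi (1 - 2 * int n) / b) (q ^ 3) n = (- 1 / b) ^ n * q powi z2 * qfac (b * q powi (2 - int n)) (q ^ 3) n"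
      by (rule refl) (use z in \<open>simp_all add: algebra_simps\<close>)
    also have "qfac (b * q powi (2 - int n)) (q ^ 3) n = qfac (b * q powi (2 - int n)) (q ^ 3) (i + (m + (m + m)))"
      by (rule arg_cong[where f = "qfac _ _"]) (simp add: n)
    also have "\<dots> = D * (Y5 * (qfac (b * q powi (2 + 2 * int i)) (q ^ 3) m * Y 2))"
    proof -
      have ex: "2 - int n + 3 * int i = 2 + 2 * int i - 3 * int m"
        "2 + 2 * int i - 3 * int m + 3 * int m = 2 + 2 * int i"
        "2 + 2 * int i + 3 * int m = int n + int i + 2"
        by (simp_all add: n)
      show ?thesis
        unfolding qfac_add mult.assoc[of b] pw ex D_def Y5_def Y_def mult.commute[of "q powi (2 - int n)" b] ..
    qed
    also have "qfac (b * q powi (2 + 2 * int i)) (q ^ 3) m = V"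
      unfolding V_def using powi_add_nat[OF q0, of 2 "2 * i"] by (simp add: mult_ac)
    finally show ?thesis by (simp only: mult.assoc)
  qed
  have X3: "qfac (q powi (2 - 2 * int n) / b) (q ^ 3) m = (- 1 / b) ^ m * q powi z3 * Y 1"
    unfolding Y_def by (rule refl) (use z in \<open>simp_all add: n algebra_simps\<close>)
  have X4: "qfac (q powi (3 - 2 * int n) / b) (q ^ 3) m = (- 1 / b) ^ m * q powi z4 * Y 0"
    unfolding Y_def by (rule refl) (use z in \<open>simp_all add: n algebra_simps\<close>)
  have X5: "X5 = (- 1 / b) ^ m * q powi z5 * Y5"
  proof -
    have "q / (b * q ^ (2 * i)) = q powi (1 - 2 * int i) / b"
      using powi_add_nat[OF q0, of "1 - 2 * int i" "2 * i"] q0 b0 by (simp add: field_simps)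
    then show ?thesis
      unfolding Y5_def X5_def by (simp only:, intro refl) (use z in \<open>simp_all add: algebra_simps\<close>)
  qed
  \<comment> \<open>The division by 6 in the exponent is exact: for n = i + 3m the numerator is 6
    times an integer built from the pentagonal numbers \<open>p\<close> and
    \<open>r\<close>.\<close>
  have e6: "6 * e = (10 * int n + 6 * int l - 2) * int i - int n - (int n) ^ 2"
  proof -
    define p r where "p = (int i * (3 * int i - 1)) div 2" and "r = (int m * (3 * int m + 1)) div 2"
    have pr: "2 * p = int i * (3 * int i - 1)" "2 * r = int m * (3 * int m + 1)"
      unfolding p_def r_def by - (rule double_div_2, force)+
    have "(10 * int n + 6 * int l - 2) * int i - int n - (int n) ^ 2 =
       6 * (p + 4 * int m * int i + int l * int i - r)"
      using pr unfolding n by (simp add: algebra_simps power2_eq_square)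
    then show ?thesis
      unfolding e_def by simp
  qed
  have exps: "z1 + (e - int l * int i) + z5 = int (\<Sum>{..<i} + i) + z2 + z3 + z4"
  proof -
    have T: "2 * int (\<Sum>{..<i}) = int i * (int i - 1)"
      by (induction i) (simp_all add: algebra_simps)
    show ?thesis
      using z T e6 unfolding n by (simp add: algebra_simps power2_eq_square)
  qed
  have qpow: "q powi z1 * q powi (e - int l * int i) * q powi z5 =
      q ^ (\<Sum>{..<i} + i) * q powi z2 * q powi z3 * q powi z4"
    using exps q0 unfolding power_int_of_nat[symmetric] by (simp flip: power_int_add)
  have sign: "(- 1) ^ n = (- 1) ^ i * ((- 1 / b) ^ m * b ^ m)"
    unfolding n using b0 by (simp add: power_add power_mult flip: power_mult_distrib)
  have ql: "q powi e * qfac (q powi (- int l)) q i = q powi (e - int l * int i) * qfall (q ^ l) q i"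
    unfolding qfac_powi_eq_qfall[OF q0] using q0 by (simp add: power_int_diff power_int_minus field_simps)
  have vw: "(q - q ^ (2 * i) * b) / (q - b) = (1 - b / q * q ^ (2 * i)) / (1 - b / q)"
    using q0 by (simp add: divide_simps)
  have cv: "cubic_value (b * q ^ (2 * i)) q (n - i) = qfac q (q ^ 3) m * qfac (q ^ 2) (q ^ 3) m / (X5 * V)"
    unfolding cubic_value_def X5_def V_def n by simp
  have rt: "qratio b q n i = qfac (q powi (- int n)) q i / D"
    unfolding qratio_eq_qfac[OF q0] D_def ..
  \<comment> \<open>Again pure cancellation; the last three assumptions stand for
    \<open>qpow\<close>, \<open>sign\<close> and \<open>ql\<close>.\<close>
  have alg: "(cn * P1 * (G * (Ya * Yb * Yc))) / (cn * P2 * (D * (Y5 * V * Yc)))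
      * (sn * (E * S / bm) * vv * ((L * N * B) / (Qi * C * G)) * (RR / (cm * P3 * Yb * (cm * P4 * Ya))))
    = (vv * B * W / C * S) * si * T / Qi * (N / D) * (RR / (cm * P5 * Y5 * V))"
    if "cn \<noteq> 0" "cm \<noteq> 0" "bm \<noteq> 0" "P2 \<noteq> 0" "P3 \<noteq> 0" "P4 \<noteq> 0" "P5 \<noteq> 0" "G \<noteq> 0" "Ya \<noteq> 0" "Yb \<noteq> 0" "Yc \<noteq> 0"
      "D \<noteq> 0" "Y5 \<noteq> 0" "V \<noteq> 0" "P1 * E' * P5 = T * P2 * P3 * P4" "sn = si * (cm * bm)" "E * L = E' * W"
    for cn P1 G Ya Yb Yc P2 D Y5 V sn E S bm vv L N B Qi C RR cm P3 P4 W si T P5 E' :: 'a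
  proof -
    have P1: "P1 * E' = T * P2 * P3 * P4 / P5"
      using that by (simp add: field_simps)
    have "(cn * P1 * (G * (Ya * Yb * Yc))) / (cn * P2 * (D * (Y5 * V * Yc)))
      * (sn * (E * S / bm) * vv * ((L * N * B) / (Qi * C * G)) * (RR / (cm * P3 * Yb * (cm * P4 * Ya))))
      = P1 * (E * L) * sn * S * vv * N * B * RR / (P2 * D * Y5 * V * bm * Qi * C * cm * cm * P3 * P4)"
      using that(1-14) by (simp add: mult_ac)
    also have "\<dots> = (P1 * E') * W * si * S * vv * N * B * RR / (P2 * D * Y5 * V * Qi * C * cm * P3 * P4)"
      unfolding that(16,17) using that(1-14) by (simp add: mult_ac)
    also have "\<dots> = (vv * B * W / C * S) * si * T / Qi * (N / D) * (RR / (cm * P5 * Y5 * V))"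
      unfolding P1 using that(1-14) by (simp add: mult_ac)
    finally show ?thesis .
  qed
  have nzs: "G \<noteq> 0" "Y r \<noteq> 0" "D \<noteq> 0" "Y5 \<noteq> 0" "V \<noteq> 0" for r
    using nz[of "int n" 1 i] nz[of _ 3] nz[of "int (2 * i + 2)" 3 m] q0
    unfolding G_def Y_def D_def Y5_def V_def power_int_of_nat
    by (simp_all add: mult_ac power_add power2_eq_square)
  show ?thesis
    unfolding b_def[symmetric] vwp_coeff_def e_def[symmetric] X1 X2 X3 X4 cv X5 vw rt G_def[symmetric]
    by (rule alg[OF _ _ _ _ _ _ _ nzs(1) nzs(2) nzs(2) nzs(2) nzs(3-5) qpow sign ql]) (use b0 q0 in auto)
qed

text \<open>Combines \<open>generic_reduction\<close> with \<open>rhs_summand\<close>. Outside the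
  index set the term vanishes, through \<open>qfall (q ^ l) q i\<close> or through
  \<open>cubic_value\<close>. For n = i + 3m the quotient \<open>s ^ i / (s ^ 2) ^ m\<close> is s to
  the power -(2n-5i)/3.\<close>

lemma generic_identity:
  fixes s q :: "'a::field"
  assumes q0: "q \<noteq> 0" and s0: "s \<noteq> 0"
    and q: "\<And>j. 0 < j \<Longrightarrow> j \<le> n \<Longrightarrow> q ^ j \<noteq> 1"
    and gen: "\<And>j. s ^ 2 * q powi j \<noteq> 1"
  shows "(\<Sum>k\<le>n. 1 / qfac (q powi (2 - int n) * s ^ 2) (q ^ 3) k
        * ((qfac (q powi (- int n)) q k * qfac (q ^ l * s) q k * qfac (- s) q k * qfac (q * s ^ 2) (q ^ 2) k)
           / (qfac q q k * qfac (q ^ l * s ^ 2) q k)) * q ^ k)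
    = qfac (q powi (1 - 2 * int n) / s ^ 2) q n / qfac (q powi (1 - 2 * int n) / s ^ 2) (q ^ 3) n
     * (\<Sum>i | i \<le> l \<and> i \<le> n \<and> 3 dvd n - i. (- 1) ^ n
       * (q powi (((10 * int n + 6 * int l - 2) * int i - int n - (int n) ^ 2) div 6) * s ^ i
          / (s ^ 2) ^ ((n - i) div 3))
       * ((q - q ^ (2 * i) * s ^ 2) / (q - s ^ 2))
       * ((qfac (q powi (- int l)) q i * qfac (q powi (- int n)) q i * qfac (s ^ 2 / q) q i)
          / (qfac q q i * qfac (q ^ l * s ^ 2) q i * qfac (q ^ n * s ^ 2) q i))
       * ((qfac q (q ^ 3) ((n - i) div 3) * qfac (q ^ 2) (q ^ 3) ((n - i) div 3))
          / (qfac (q powi (2 - 2 * int n) / s ^ 2) (q ^ 3) ((n - i) div 3)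
             * qfac (q powi (3 - 2 * int n) / s ^ 2) (q ^ 3) ((n - i) div 3))))"
proof -
  have restrict: "(\<Sum>i | i \<le> l \<and> i \<le> n \<and> 3 dvd n - i. vwp_coeff s q l i * (- 1) ^ i * q ^ (\<Sum>{..<i} + i) / qfac q q i
          * qratio (s ^ 2) q n i * cubic_value (s ^ 2 * q ^ (2 * i)) q (n - i))
     = (\<Sum>i\<le>n. vwp_coeff s q l i * (- 1) ^ i * q ^ (\<Sum>{..<i} + i) / qfac q q i
          * qratio (s ^ 2) q n i * cubic_value (s ^ 2 * q ^ (2 * i)) q (n - i))"
  proof (rule sum.mono_neutral_left)
    have "vwp_coeff s q l i = 0" if "l < i" for i
      by (simp add: vwp_coeff_def qfall_power_eq_0[OF that])
    moreover have "cubic_value (s ^ 2 * q ^ (2 * i)) q (n - i) = 0" if "\<not> 3 dvd n - i" for i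
      using that by (simp add: cubic_value_def)
    ultimately show "\<forall>i\<in>{..n} - {i. i \<le> l \<and> i \<le> n \<and> 3 dvd n - i}.
        vwp_coeff s q l i * (- 1) ^ i * q ^ (\<Sum>{..<i} + i) / qfac q q i
          * qratio (s ^ 2) q n i * cubic_value (s ^ 2 * q ^ (2 * i)) q (n - i) = 0"
      by (metis (no_types, lifting) DiffE atMost_iff div_0 mem_Collect_eq mult_zero_left mult_zero_right not_le)
  qed auto
  show ?thesis
    unfolding sum_distrib_left
    by (rule trans[OF generic_reduction[OF q0 s0 q gen]], assumption, assumption, subst restrict[symmetric])
      (intro sum.cong refl rhs_summand[OF q0 s0 gen, symmetric], auto)
qed

section \<open>Removing genericity by continuity\<close>

text \<open>If \<open>f a\<close> and \<open>g a\<close> differed, then \<open>f\<close> and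
  \<open>g\<close> would differ throughout a ball around \<open>a\<close>, and a ball is never
  contained in a countable set.\<close>

lemma isCont_eq_off_countable:
  fixes f g :: "complex \<Rightarrow> complex"
  assumes C: "countable C" and f: "isCont f a" and g: "isCont g a"
    and eq: "\<And>s. s \<notin> C \<Longrightarrow> f s = g s"
  shows "f a = g a"
proof (rule ccontr)
  assume ne: "f a \<noteq> g a"
  have "isCont (\<lambda>s. f s - g s) a"
    using f g by (intro continuous_intros)
  then obtain d where d: "d > 0" "\<And>s. dist s a < d \<Longrightarrow> dist (f s - g s) (f a - g a) < dist (f a) (g a)"
    unfolding continuous_at_eps_delta using ne by (metis zero_less_dist_iff)
  have "ball a d - C \<noteq> {}"
    using C d(1) by (rule ball_minus_countable_nonempty)
  then obtain s where "s \<in> ball a d" "s \<notin> C"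
    by blast
  then show False
    using d(2)[of s] eq[of s] by (simp add: dist_norm norm_minus_commute)
qed

lemma isCont_qfac [continuous_intros]:
  fixes f :: "complex \<Rightarrow> complex"
  assumes "isCont f a"
  shows "isCont (\<lambda>s. qfac (f s) q k) a"
  unfolding qfac_def using assms by (intro continuous_intros)

lemma qpoch_of_nat: "qpoch x q (int k) = qfac x q k"
proof -
  have "(\<Prod>j\<in>{0..int k - 1}. 1 - x * q powi j) = (\<Prod>j<k. 1 - x * q ^ j)"
    by (rule prod.reindex_bij_witness[where i = int and j = nat]) (auto simp: power_int_def)
  then show ?thesis
    by (simp add: qpoch_def qfac_def)
qed

theorem theorem7:
  fixes l n :: nat and b q sqrt_b sqrt_qb :: complex
  assumes "b \<noteq> 0" and "q \<noteq> 0"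
    and sqrt_b: "sqrt_b ^ 2 = b"
    and sqrt_qb: "sqrt_qb ^ 2 = q * b"
    and lhs_denominators: "\<And>k. k \<le> n \<Longrightarrow>
          qpoch (q powi (2 - int n) * b) (q ^ 3) (int k) \<noteq> 0 \<and>
          qpoch q q (int k) \<noteq> 0 \<and>
          qpoch (q ^ l * b) q (int k) \<noteq> 0"
    and prefactor_denominator:
          "qpoch (q powi (1 - 2 * int n) / b) (q ^ 3) (int n) \<noteq> 0"
    and rhs_denominators: "\<And>i. i \<le> l \<Longrightarrow> 3 dvd (int n - int i) \<Longrightarrow>
          q - b \<noteq> 0 \<and>
          qpoch q q (int i) \<noteq> 0 \<and>
          qpoch (q ^ l * b) q (int i) \<noteq> 0 \<and>
          qpoch (q ^ n * b) q (int i) \<noteq> 0 \<and>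
          qpoch (q powi (2 - 2 * int n) / b) (q ^ 3) ((int n - int i) div 3) \<noteq> 0 \<and>
          qpoch (q powi (3 - 2 * int n) / b) (q ^ 3) ((int n - int i) div 3) \<noteq> 0"
    and rhs_negative_index: "\<And>i. i \<le> l \<Longrightarrow> 3 dvd (int n - int i) \<Longrightarrow> n < i \<Longrightarrow>
          qpoch q (q ^ 3) ((int n - int i) div 3) \<noteq> 0 \<and>
          qpoch (q ^ 2) (q ^ 3) ((int n - int i) div 3) \<noteq> 0"
  shows
    "(\<Sum>k = 0..n.
        1 / qpoch (q powi (2 - int n) * b) (q ^ 3) (int k)
        * ((qpoch (q powi (- int n)) q (int k) * qpoch (q ^ l * sqrt_b) q (int k)
             * qpoch (- sqrt_b) q (int k) * qpoch sqrt_qb q (int k) * qpoch (- sqrt_qb) q (int k))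
           / (qpoch q q (int k) * qpoch (q ^ l * b) q (int k)))
        * q ^ k)
     = qpoch (q powi (1 - 2 * int n) / b) q (int n)
         / qpoch (q powi (1 - 2 * int n) / b) (q ^ 3) (int n)
       * (\<Sum>i = 0..l.
           (- 1) ^ n
           * (q powi (((10 * int n + 6 * int l - 2) * int i - int n - (int n) ^ 2) div 6)
              / sqrt_b powi ((2 * int n - 5 * int i) div 3))
           * ((q - q ^ (2 * i) * b) / (q - b))
           * ((qpoch (q powi (- int l)) q (int i) * qpoch (q powi (- int n)) q (int i)
                * qpoch (b / q) q (int i))
              / (qpoch q q (int i) * qpoch (q ^ l * b) q (int i) * qpoch (q ^ n * b) q (int i)))
           * ((qpoch q (q ^ 3) ((int n - int i) div 3) * qpoch (q ^ 2) (q ^ 3) ((int n - int i) div 3))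
              / (qpoch (q powi (2 - 2 * int n) / b) (q ^ 3) ((int n - int i) div 3)
                 * qpoch (q powi (3 - 2 * int n) / b) (q ^ 3) ((int n - int i) div 3)))
           * chi (int n - int i))"
proof -
  define I where "I = {i. i \<le> l \<and> i \<le> n \<and> 3 dvd n - i}"
  define L where "L s = (\<Sum>k\<le>n. 1 / qfac (q powi (2 - int n) * s ^ 2) (q ^ 3) k
        * ((qfac (q powi (- int n)) q k * qfac (q ^ l * s) q k * qfac (- s) q k * qfac (q * s ^ 2) (q ^ 2) k)
           / (qfac q q k * qfac (q ^ l * s ^ 2) q k)) * q ^ k)" for s
  define T where "T s i = (- 1) ^ n
       * (q powi (((10 * int n + 6 * int l - 2) * int i - int n - (int n) ^ 2) div 6) * s ^ i
          / (s ^ 2) ^ ((n - i) div 3))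
       * ((q - q ^ (2 * i) * s ^ 2) / (q - s ^ 2))
       * ((qfac (q powi (- int l)) q i * qfac (q powi (- int n)) q i * qfac (s ^ 2 / q) q i)
          / (qfac q q i * qfac (q ^ l * s ^ 2) q i * qfac (q ^ n * s ^ 2) q i))
       * ((qfac q (q ^ 3) ((n - i) div 3) * qfac (q ^ 2) (q ^ 3) ((n - i) div 3))
          / (qfac (q powi (2 - 2 * int n) / s ^ 2) (q ^ 3) ((n - i) div 3)
             * qfac (q powi (3 - 2 * int n) / s ^ 2) (q ^ 3) ((n - i) div 3)))" for s i
  define R where "R s = qfac (q powi (1 - 2 * int n) / s ^ 2) q n
      / qfac (q powi (1 - 2 * int n) / s ^ 2) (q ^ 3) n * (\<Sum>i\<in>I. T s i)" for s
  have q0: "q \<noteq> 0" and b0: "b \<noteq> 0"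
    using assms by simp_all
  have s0: "sqrt_b \<noteq> 0"
    using b0 sqrt_b by auto
  have idx: "(int n - int i) div 3 = int ((n - i) div 3)" "3 dvd int n - int i"
    "int n = int i + 3 * int ((n - i) div 3)" if "i \<in> I" for i
  proof -
    have "3 dvd n - i" "i \<le> n"
      using that by (simp_all add: I_def)
    then obtain m where "n - i = 3 * m"
      by (elim dvdE)
    with \<open>i \<le> n\<close> have "n = i + 3 * m"
      by simp
    then show "(int n - int i) div 3 = int ((n - i) div 3)" "3 dvd int n - int i"
      "int n = int i + 3 * int ((n - i) div 3)"
      by simp_all
  qed
  have lhs_nz: "qfac (q powi (2 - int n) * b) (q ^ 3) k \<noteq> 0" "qfac q q k \<noteq> 0" "qfac (q ^ l * b) q k \<noteq> 0"
    if "k \<le> n" for k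
    using lhs_denominators[OF that] by (simp_all add: qpoch_of_nat)
  have pre_nz: "qfac (q powi (1 - 2 * int n) / b) (q ^ 3) n \<noteq> 0"
    using prefactor_denominator by (simp add: qpoch_of_nat)
  have rhs_nz: "q - b \<noteq> 0" "qfac q q i \<noteq> 0" "qfac (q ^ l * b) q i \<noteq> 0" "qfac (q ^ n * b) q i \<noteq> 0"
    "qfac (q powi (2 - 2 * int n) / b) (q ^ 3) ((n - i) div 3) \<noteq> 0"
    "qfac (q powi (3 - 2 * int n) / b) (q ^ 3) ((n - i) div 3) \<noteq> 0" if "i \<in> I" for i
    using rhs_denominators[of i] idx[OF that] that by (simp_all add: qpoch_of_nat I_def)
  define C where "C = insert 0 (\<Union>j. {s. s ^ 2 = q powi j})"
  have "L sqrt_b = R sqrt_b"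
  proof (rule isCont_eq_off_countable[where f = L and g = R])
    show "countable C"
      unfolding C_def by (intro countable_insert countable_UN) (auto intro!: countable_finite finite_nth_roots)
    \<comment> \<open>Continuity is needed only at \<open>sqrt_b\<close>, which may lie in
      \<open>C\<close>; the denominators assumed nonzero in the theorem are enough for it.\<close>
    show "isCont L sqrt_b"
      unfolding L_def using lhs_nz by (intro continuous_intros) (auto simp: sqrt_b)
    show "isCont R sqrt_b"
    proof -
      have "isCont (\<lambda>s. T s i) sqrt_b" if "i \<in> I" for i
        unfolding T_def
        by (intro continuous_const isCont_mult isCont_divide isCont_diff isCont_power isCont_qfac continuous_ident)
          (use rhs_nz[OF that] b0 s0 q0 in \<open>simp_all only: sqrt_b mult_eq_0_iff power_not_zero simp_thms\<close>)
      then show ?thesis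
        unfolding R_def using pre_nz s0 b0
        by (intro isCont_mult isCont_divide isCont_qfac isCont_power continuous_const continuous_ident isCont_sum ballI)
          (simp_all add: sqrt_b)
    qed
    show "L s = R s" if "s \<notin> C" for s
      unfolding L_def R_def T_def I_def
    proof (rule generic_identity[OF q0])
      show "s \<noteq> 0"
        using that by (simp add: C_def)
      show "q ^ j \<noteq> 1" if "0 < j" "j \<le> n" for j
        using lhs_nz(2)[of n] that unfolding qfac_nonzero_iff
        by (metis Suc_pred' less_le_trans order_refl Suc_le_lessD power_Suc)
      show "s ^ 2 * q powi j \<noteq> 1" for j
      proof
        assume "s ^ 2 * q powi j = 1"
        then have "s ^ 2 = q powi (- j)"
          using q0 by (simp add: power_int_minus field_simps)
        then show False
          using that by (auto simp: C_def)
      qed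
    qed
  qed
  also have "L sqrt_b = (\<Sum>k = 0..n.
        1 / qpoch (q powi (2 - int n) * b) (q ^ 3) (int k)
        * ((qpoch (q powi (- int n)) q (int k) * qpoch (q ^ l * sqrt_b) q (int k)
             * qpoch (- sqrt_b) q (int k) * qpoch sqrt_qb q (int k) * qpoch (- sqrt_qb) q (int k))
           / (qpoch q q (int k) * qpoch (q ^ l * b) q (int k)))
        * q ^ k)"
    unfolding L_def qpoch_of_nat sqrt_b atLeast0AtMost using qfac_minus[of sqrt_qb q]
    by (simp add: sqrt_qb mult.assoc)
  also have "R sqrt_b = qpoch (q powi (1 - 2 * int n) / b) q (int n)
         / qpoch (q powi (1 - 2 * int n) / b) (q ^ 3) (int n) * (\<Sum>i\<in>I. T sqrt_b i)"
    by (simp only: R_def sqrt_b qpoch_of_nat)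
  also have "(\<Sum>i\<in>I. T sqrt_b i) = (\<Sum>i = 0..l.
           (- 1) ^ n
           * (q powi (((10 * int n + 6 * int l - 2) * int i - int n - (int n) ^ 2) div 6)
              / sqrt_b powi ((2 * int n - 5 * int i) div 3))
           * ((q - q ^ (2 * i) * b) / (q - b))
           * ((qpoch (q powi (- int l)) q (int i) * qpoch (q powi (- int n)) q (int i)
                * qpoch (b / q) q (int i))
              / (qpoch q q (int i) * qpoch (q ^ l * b) q (int i) * qpoch (q ^ n * b) q (int i)))
           * ((qpoch q (q ^ 3) ((int n - int i) div 3) * qpoch (q ^ 2) (q ^ 3) ((int n - int i) div 3))
              / (qpoch (q powi (2 - 2 * int n) / b) (q ^ 3) ((int n - int i) div 3)
                 * qpoch (q powi (3 - 2 * int n) / b) (q ^ 3) ((int n - int i) div 3)))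
           * chi (int n - int i))"
    (is "_ = sum ?F _")
  proof (rule sum.mono_neutral_cong_left)
    show "\<forall>i\<in>{0..l} - I. ?F i = 0"
    proof
      fix i assume i: "i \<in> {0..l} - I"
      \<comment> \<open>For \<open>i > n\<close> the product (q^-n;q)_i contains the factor 1 - q^-n
        q^n = 0, which removes the summands whose index (n-i)/3 is negative.\<close>
      have "chi (int n - int i) = 0 \<or> qpoch (q powi (- int n)) q (int i) = 0"
      proof (cases "i \<le> n")
        case True
        then have "\<not> 3 dvd n - i"
          using i by (auto simp: I_def)
        then have "\<not> 3 dvd int n - int i"
          using True by (metis of_nat_diff of_nat_dvd_iff of_nat_numeral)
        then show ?thesis
          by (simp add: chi_def)
      next
        case False
        then show ?thesis
          by (simp add: qpoch_of_nat qfac_powi_eq_qfall[OF q0] qfall_power_eq_0)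
      qed
      then show "?F i = 0"
        by (elim disjE) simp_all
    qed
    fix i assume i: "i \<in> I"
    define m where "m = (n - i) div 3"
    have nm: "int n = int i + 3 * int m"
      using idx(3)[OF i] by (simp add: m_def)
    have "(2 * int n - 5 * int i) div 3 = 2 * int m - int i"
      unfolding nm by simp
    moreover have "x / sqrt_b powi (2 * int m - int i) = x * sqrt_b ^ i / b ^ m" for x
    proof -
      have "sqrt_b powi (2 * int m - int i) = b ^ m / sqrt_b ^ i"
        using s0 power_int_mult[of sqrt_b 2 "int m"] by (simp add: power_int_diff sqrt_b)
      then show ?thesis by simp
    qed
    moreover have "chi (int n - int i) = 1"
      using idx(2)[OF i] by (simp add: chi_def)
    ultimately show "T sqrt_b i = ?F i"
      unfolding T_def idx(1)[OF i] qpoch_of_nat sqrt_b m_def[symmetric] by simp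
  qed (auto simp: I_def)
  finally show ?thesis .
qed

end
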